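(* Let $G=(V,E)$ be a $k$-connected directed graph on $V=\{1,\dots,n\}$ with $(i,i)\in E$ for all $i\in V$. For almost every consensus matrix $A$ on $G$ the following hold. (1) Let $m=\lfloor\frac{k-1}{2}\rfloor$ and let $\mathcal{K}$ be the family of all subsets of $V$ of cardinality $m$. Then for every nonempty $K\in\mathcal{K}$, every input $u_K:\mathbb{N}\to\mathbb{R}^{m}$ for which all agents of $K$ are misbehaving is identifiable. (2) Let $\mathcal{K}$ be the family of all subsets of $V$ of cardinality $k-1$. Then for every nonempty $K\in\mathcal{K}$ there exists an identifiable input $u_K:\mathbb{N}\to\mathbb{R}^{k-1}$ for which all agents of $K$ are misbehaving.
   Context: $\mathbb{N}=\{0,1,2,\dots\}$. A consensus matrix on $G$ is a real $n\times n$ row stochastic (nonnegative entries, rows summing to one), primitive matrix $A$ with $A_{ij}=0$ whenever $(j,i)\notin E$. The set of consensus matrices on $G$ is viewed as a subset $S$ of the Euclidean space of free entries $A_{ij}$, $(j,i)\in E$; since rows sum to one it lies in an affine subspace, and "almost every" means that the set of exceptions in $S$ has Lebesgue measure zero in that affine subspace (so that the good set is dense in $S$). $G$ is $k$-connected if its connectivity is $k$, where the connectivity is the maximum number of disjoint paths between any two vertices, equivalently the minimum number of vertices in a vertex cutset; a complete graph has connectivity $n-1$. The neighbor set of $j$ is $N_j=\{i\in V:(i,j)\in E\}$ (so $j\in N_j$). For $K=\{i_1,i_2,\dots\}\subseteq V$, $B_K=[e_{i_1}\ e_{i_2}\ \cdots]$ with $e_i$ the canonical basis vectors. For $j\in V$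 with $N_j=\{n_1,\dots,n_p\}$, $C_j=[e_{n_1}\ \cdots\ e_{n_p}]^{\mathsf T}$, and $y_j(x_0,u_K,t)=C_jx(t)$ for $x(t+1)=Ax(t)+B_Ku_K(t)$, $x(0)=x_0$. An agent $i\in K$ is misbehaving if its input component $u_i(t)$ is nonzero for some $t\in\mathbb{N}$. For nonempty $K_1\in\mathcal{K}$, an input $u_{K_1}$ is unidentifiable if there exist $K_2\in\mathcal{K}$ with $K_2\neq K_1$, an input $u_{K_2}$, $x_1,x_2\in\mathbb{R}^n$ and $j\in V$ with $y_j(x_1,u_{K_1},t)=y_j(x_2,u_{K_2},t)$ for all $t\in\mathbb{N}$; it is identifiable otherwise. *)

theory Defs
  imports "Graph_Theory.Digraph_Component" "HOL-Analysis.Analysis"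
begin

section \<open>Vertex connectivity of digraphs\<close>

text \<open>
  Removing \<open>S\<close> leaves a nonempty digraph in which some vertex cannot reach another one.
  Loops are irrelevant here and in \<open>complete_graph\<close> below.
\<close>

definition vertex_cutset :: "('a, 'b) pre_digraph \<Rightarrow> 'a set \<Rightarrow> bool" where
  "vertex_cutset G S \<longleftrightarrow>
     S \<subset> verts G \<and> \<not> strongly_connected (G \<restriction> (verts G - S))"

definition complete_graph :: "('a, 'b) pre_digraph \<Rightarrow> bool" where
  "complete_graph G \<longleftrightarrow> (\<forall>u \<in> verts G. \<forall>v \<in> verts G. u \<noteq> v \<longrightarrow> (u, v) \<in> arcs_ends G)"

text \<open>
  For a finite digraph that is not complete the set under \<open>Min\<close> is finite and nonempty:
  if the arc \<open>(u, v)\<close> is missing, all vertices other than \<open>u\<close> and \<open>v\<close> form a cutset.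
\<close>

definition vertex_connectivity :: "('a, 'b) pre_digraph \<Rightarrow> nat" where
  "vertex_connectivity G =
     (if complete_graph G then card (verts G) - 1 else Min (card ` {S. vertex_cutset G S}))"

definition k_connected :: "nat \<Rightarrow> ('a, 'b) pre_digraph \<Rightarrow> bool" where
  "k_connected k G \<longleftrightarrow> vertex_connectivity G = k"

definition nbrs :: "('a, 'b) pre_digraph \<Rightarrow> 'a \<Rightarrow> 'a set" where
  "nbrs G j = {i \<in> verts G. (i, j) \<in> arcs_ends G}"


section \<open>Consensus matrices\<close>

primrec mat_pow :: "real ^ 'n ^ 'n \<Rightarrow> nat \<Rightarrow> real ^ 'n ^ 'n" where
  "mat_pow A 0 = mat 1"
| "mat_pow A (Suc h) = A ** mat_pow A h"

definition primitive_matrix :: "real ^ 'n ^ 'n \<Rightarrow> bool" where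
  "primitive_matrix A \<longleftrightarrow>
     (\<forall>i j. 0 \<le> A $ i $ j) \<and> (\<exists>h > 0. \<forall>i j. 0 < mat_pow A h $ i $ j)"

definition row_stochastic :: "real ^ 'n ^ 'n \<Rightarrow> bool" where
  "row_stochastic A \<longleftrightarrow> (\<forall>i j. 0 \<le> A $ i $ j) \<and> (\<forall>i. (\<Sum>j\<in>UNIV. A $ i $ j) = 1)"

definition consensus_matrix :: "('n, 'b) pre_digraph \<Rightarrow> real ^ 'n ^ 'n \<Rightarrow> bool" where
  "consensus_matrix G A \<longleftrightarrow>
     row_stochastic A \<and> primitive_matrix A \<and> (\<forall>i j. (j, i) \<notin> arcs_ends G \<longrightarrow> A $ i $ j = 0)"

text \<open>
  The Euclidean space of the free entries is identified with the matrices that vanish off the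
  arcs; inside it, the condition on the row sums cuts out the following affine subspace.
\<close>

definition consensus_space :: "('n, 'b) pre_digraph \<Rightarrow> (real ^ 'n ^ 'n) set" where
  "consensus_space G =
     {A. (\<forall>i j. (j, i) \<notin> arcs_ends G \<longrightarrow> A $ i $ j = 0) \<and> (\<forall>i. (\<Sum>j\<in>UNIV. A $ i $ j) = 1)}"


section \<open>Lebesgue measure on an affine subspace\<close>

definition orthonormal_basis_of :: "'a::euclidean_space set \<Rightarrow> 'a set \<Rightarrow> bool" where
  "orthonormal_basis_of U B \<longleftrightarrow>
     pairwise orthogonal B \<and> (\<forall>b\<in>B. norm b = 1) \<and> span B = U"

text \<open>
  Image of the product Lebesgue measure under a Cartesian coordinate system (origin \<open>a\<close>,
  orthonormal axes \<open>B\<close>) of the nonempty affine subspace \<open>M\<close>. It does not depend on the chosen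
  coordinate system, since two of them differ by an isometry. On a one-point subspace
  it is the unit point mass. Completing the measure would not change \<open>AE\<close>.
\<close>

definition lborel_affine :: "'a::euclidean_space set \<Rightarrow> 'a measure" where
  "lborel_affine M =
     (let a = (SOME a. a \<in> M);
          B = (SOME B. orthonormal_basis_of {x - y |x y. x \<in> M \<and> y \<in> M} B)
      in distr (\<Pi>\<^sub>M b\<in>B. lborel) (restrict_space borel M) (\<lambda>c. a + (\<Sum>b\<in>B. c b *\<^sub>R b)))"


section \<open>Consensus dynamics with inputs\<close>

text \<open>
  An input \<open>u\<close> of the agents in \<open>K\<close> has a component \<open>u t i\<close> for every \<open>i \<in> K\<close>, so that no
  enumeration of \<open>K\<close> is needed; the values \<open>u t i\<close> with \<open>i \<notin> K\<close> are never used.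
\<close>

definition apply_B :: "'n set \<Rightarrow> ('n \<Rightarrow> real) \<Rightarrow> real ^ 'n" where
  "apply_B K v = (\<Sum>i\<in>K. v i *\<^sub>R axis i 1)"

primrec state ::
  "real ^ 'n ^ 'n \<Rightarrow> 'n set \<Rightarrow> real ^ 'n \<Rightarrow> (nat \<Rightarrow> 'n \<Rightarrow> real) \<Rightarrow> nat \<Rightarrow> real ^ 'n" where
  "state A K x0 u 0 = x0"
| "state A K x0 u (Suc t) = A *v state A K x0 u t + apply_B K (u t)"

text \<open>The components of \<open>C\<^sub>j x(t)\<close> are indexed by the neighbors of \<open>j\<close> themselves.\<close>

definition agent_output ::
  "('n, 'b) pre_digraph \<Rightarrow> real ^ 'n ^ 'n \<Rightarrow> 'n \<Rightarrow> 'n set \<Rightarrow> real ^ 'n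
     \<Rightarrow> (nat \<Rightarrow> 'n \<Rightarrow> real) \<Rightarrow> nat \<Rightarrow> 'n \<Rightarrow> real" where
  "agent_output G A j K x0 u t = (\<lambda>i\<in>nbrs G j. state A K x0 u t $ i)"

definition misbehaving :: "(nat \<Rightarrow> 'n \<Rightarrow> real) \<Rightarrow> 'n \<Rightarrow> bool" where
  "misbehaving u i \<longleftrightarrow> (\<exists>t. u t i \<noteq> 0)"

definition unidentifiable ::
  "('n, 'b) pre_digraph \<Rightarrow> real ^ 'n ^ 'n \<Rightarrow> 'n set set \<Rightarrow> 'n set \<Rightarrow> (nat \<Rightarrow> 'n \<Rightarrow> real) \<Rightarrow> bool"
where
  "unidentifiable G A \<K> K\<^sub>1 u\<^sub>1 \<longleftrightarrow>
     (\<exists>K\<^sub>2 \<in> \<K>. K\<^sub>2 \<noteq> K\<^sub>1 \<and>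
        (\<exists>u\<^sub>2 x\<^sub>1 x\<^sub>2. \<exists>j \<in> verts G. \<forall>t.
           agent_output G A j K\<^sub>1 x\<^sub>1 u\<^sub>1 t = agent_output G A j K\<^sub>2 x\<^sub>2 u\<^sub>2 t))"

abbreviation identifiable ::
  "('n, 'b) pre_digraph \<Rightarrow> real ^ 'n ^ 'n \<Rightarrow> 'n set set \<Rightarrow> 'n set \<Rightarrow> (nat \<Rightarrow> 'n \<Rightarrow> real) \<Rightarrow> bool"
where
  "identifiable G A \<K> K u \<equiv> \<not> unidentifiable G A \<K> K u"

end

theory Submission
  imports Defs "HOL-Computational_Algebra.Fundamental_Theorem_Algebra"
begin

text \<open>
  Almost every matrix in the affine space has off-diagonal entries that are algebraically
  independent over the rationals, and such matrices satisfy both claims.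

  The key is a dimension count for modes: vectors \<open>v\<close> over the complex numbers that vanish on the
  neighbors of \<open>j\<close> and satisfy the rows \<open>i \<notin> K\<close> of \<open>A v = z v\<close>. As the rows of \<open>A\<close> sum to one, row
  \<open>i\<close> reads \<open>\<Sum>\<^sub>l A\<^sub>i\<^sub>l (v\<^sub>l - v\<^sub>i) = (z - 1) v\<^sub>i\<close>; unless \<open>v\<close> is constant on the in-neighbors of \<open>i\<close>, it
  expresses one entry of \<open>A\<close> by the remaining ones, \<open>z\<close> and \<open>v\<close>. Independence therefore bounds the
  number of such rows by the number of values of \<open>v\<close> and \<open>z\<close> (after scaling), whereas
  \<open>k\<close>-connectivity provides too many of them: a set \<open>S\<close> of vertices that does not reach \<open>j\<close> in one
  step has at least \<open>card S + k\<close> out-neighbors, counting \<open>S\<close> itself. So \<open>v = 0\<close> if \<open>card K < k\<close>, and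
  also if \<open>card K = k\<close> provided that \<open>z\<close> is rational and not \<open>1\<close>.

  For the first claim, a nonzero state sequence with inputs in \<open>K\<^sub>1 \<union> K\<^sub>2\<close> and zero output would yield
  a mode: take a polynomial \<open>p\<close> of least degree with \<open>\<Sum>\<^sub>t p\<^sub>t x(t) = 0\<close>, a root \<open>z\<close> of it, and the
  combination of states given by the coefficients of \<open>p / (X - z)\<close>. For the second claim, the inputs
  that a given \<open>K\<^sub>2\<close> can imitate at a given \<open>j\<close> form a subspace, and finitely many proper subspaces do
  not cover the space of inputs. The subspace is proper, since otherwise more than \<open>2 n\<close> impulses
  of an agent \<open>i \<in> K\<^sub>1 - K\<^sub>2\<close> would be imitated, and a nontrivial combination of the resulting state
  sequences would start and end at \<open>0\<close>; its transform \<open>\<Sum>\<^sub>t x(t) z\<^bsup>T - t\<^esup>\<close> is a mode for every \<open>z\<close>, hence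
  zero for all rational \<open>z \<noteq> 1\<close>.
\<close>

section \<open>Algebraic independence\<close>

text \<open>Gaussian elimination: an equation with a nonzero coefficient is solved for the unknown
  \<open>x0\<close>, which is then eliminated from the others. It is used over the rationals, the
  reals and the complex numbers.\<close>

lemma homogeneous_system_nontrivial_solution:
  fixes c :: "'x \<Rightarrow> 'y \<Rightarrow> 'f::field"
  assumes "finite X" "finite Y" "card Y < card X"
  shows "\<exists>w. (\<exists>x\<in>X. w x \<noteq> 0) \<and> (\<forall>y\<in>Y. (\<Sum>x\<in>X. w x * c x y) = 0)"
  using assms(2,1,3)
proof (induction Y arbitrary: X c rule: finite_induct)
  case empty
  then obtain x where "x \<in> X" by fastforce
  then show ?case by (intro exI[of _ "\<lambda>_. 1"]) auto
next
  case (insert y Y)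
  show ?case
  proof (cases "\<forall>x\<in>X. c x y = 0")
    case True
    have "card Y < card X" using insert by simp
    from insert.IH[OF insert.prems(1) this, of c] obtain w where
      "\<exists>x\<in>X. w x \<noteq> 0" "\<forall>y\<in>Y. (\<Sum>x\<in>X. w x * c x y) = 0" by blast
    with True show ?thesis by (intro exI[of _ w]) auto
  next
    case False
    then obtain x0 where x0: "x0 \<in> X" "c x0 y \<noteq> 0" by blast
    define X' where "X' = X - {x0}"
    define r where "r x = c x y / c x0 y" for x
    have fX': "finite X'" "card Y < card X'"
      using insert.prems insert.hyps x0 by (auto simp: X'_def)
    from insert.IH[OF this, of "\<lambda>x y'. c x y' - r x * c x0 y'"] obtain w where
      w: "\<exists>x\<in>X'. w x \<noteq> 0" "\<And>y'. y' \<in> Y \<Longrightarrow> (\<Sum>x\<in>X'. w x * (c x y' - r x * c x0 y')) = 0"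
      by blast
    define w' where "w' = w(x0 := - (\<Sum>x\<in>X'. w x * r x))"
    have eq: "(\<Sum>x\<in>X. w' x * c x y') = (\<Sum>x\<in>X'. w x * (c x y' - r x * c x0 y'))" for y'
    proof -
      have "(\<Sum>x\<in>X. w' x * c x y') = w' x0 * c x0 y' + (\<Sum>x\<in>X'. w' x * c x y')"
        unfolding X'_def by (rule sum.remove) (use insert.prems x0 in auto)
      also have "(\<Sum>x\<in>X'. w' x * c x y') = (\<Sum>x\<in>X'. w x * c x y')"
        by (rule sum.cong) (auto simp: w'_def X'_def)
      finally show ?thesis
        by (simp add: w'_def algebra_simps sum_subtractf sum_distrib_left)
    qed
    have "(\<Sum>x\<in>X'. w x * (c x y - r x * c x0 y)) = 0"
      using x0 by (simp add: r_def)
    with w eq have "\<forall>y'\<in>insert y Y. (\<Sum>x\<in>X. w' x * c x y') = 0" by simp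
    moreover have "\<exists>x\<in>X. w' x \<noteq> 0"
      using w(1) by (auto simp: w'_def X'_def)
    ultimately show ?thesis by blast
  qed
qed

section \<open>Rational polynomials, their values and the ring of these values\<close>

definition exps :: "'i set \<Rightarrow> nat \<Rightarrow> ('i \<Rightarrow> nat) set" where
  "exps I D = (I \<rightarrow>\<^sub>E {..D})"

definition mon :: "'i set \<Rightarrow> ('i \<Rightarrow> 'a::comm_ring_1) \<Rightarrow> ('i \<Rightarrow> nat) \<Rightarrow> 'a" where
  "mon I x m = (\<Prod>i\<in>I. x i ^ m i)"

text \<open>Independence over the rationals: for finite \<open>I\<close>, every polynomial has its
  exponents in some box \<open>exps I D\<close>.\<close>

definition alg_indep :: "'i set \<Rightarrow> ('i \<Rightarrow> real) \<Rightarrow> bool" where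
  "alg_indep I x \<longleftrightarrow> (\<forall>D w. (\<exists>m\<in>exps I D. w m \<noteq> 0) \<longrightarrow>
     (\<Sum>m\<in>exps I D. of_rat (w m) * mon I x m) \<noteq> 0)"

lemma complex_of_real_of_rat: "complex_of_real (of_rat q) = of_rat q"
  by (cases q) (simp add: of_rat_rat)

text \<open>The degree bound is kept because dimensions are compared later: for finite
  \<open>J\<close> these values lie in the rational span of \<open>(d + 1) ^ card J\<close>
  monomials.\<close>

definition rat_polys :: "'j set \<Rightarrow> ('j \<Rightarrow> complex) \<Rightarrow> nat \<Rightarrow> complex set" where
  "rat_polys J b d = range (\<lambda>r. \<Sum>m\<in>exps J d. of_rat (r m) * mon J b m)"

lemma finite_exps: "finite I \<Longrightarrow> finite (exps I D)"
  by (simp add: exps_def finite_PiE)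

lemma card_exps: "finite I \<Longrightarrow> card (exps I D) = (D + 1) ^ card I"
  by (simp add: exps_def card_PiE)

context
  fixes J :: "'j set" and b :: "'j \<Rightarrow> complex"
  assumes finJ: "finite J"
begin

lemma rat_polys_add: "x \<in> rat_polys J b d \<Longrightarrow> y \<in> rat_polys J b d \<Longrightarrow> x + y \<in> rat_polys J b d"
proof -
  assume "x \<in> rat_polys J b d" "y \<in> rat_polys J b d"
  then obtain r s where "x = (\<Sum>m\<in>exps J d. of_rat (r m) * mon J b m)"
    "y = (\<Sum>m\<in>exps J d. of_rat (s m) * mon J b m)"
    unfolding rat_polys_def by blast
  then have "x + y = (\<Sum>m\<in>exps J d. of_rat (r m + s m) * mon J b m)"
    by (simp add: of_rat_add distrib_right sum.distrib)
  then show ?thesis unfolding rat_polys_def by (auto intro: range_eqI[of _ _ "\<lambda>m. r m + s m"])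
qed

lemma rat_polys_monomial:
  assumes "m \<in> exps J d"
  shows "of_rat q * mon J b m \<in> rat_polys J b d"
proof -
  have "(\<Sum>m'\<in>exps J d. of_rat (if m' = m then q else 0) * mon J b m') =
      (\<Sum>m'\<in>exps J d. if m' = m then of_rat q * mon J b m else 0)"
    by (rule sum.cong) auto
  also have "\<dots> = of_rat q * mon J b m"
    using assms finite_exps[OF finJ] by simp
  finally show ?thesis
    unfolding rat_polys_def by (intro range_eqI[of _ _ "\<lambda>m'. if m' = m then q else 0"]) simp
qed

lemma rat_polys_const: "of_rat q \<in> rat_polys J b d"
proof -
  have "(\<lambda>j\<in>J. 0) \<in> exps J d" by (auto simp: exps_def)
  from rat_polys_monomial[OF this, of q] show ?thesis by (simp add: mon_def)
qed

lemma rat_polys_sum: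
  assumes "\<And>x. x \<in> X \<Longrightarrow> f x \<in> rat_polys J b d"
  shows "sum f X \<in> rat_polys J b d"
  using assms
proof (induction X rule: infinite_finite_induct)
  case (insert x X)
  then show ?case by (simp add: rat_polys_add)
qed (use rat_polys_const[of 0] in auto)

lemma rat_polys_mono:
  assumes "x \<in> rat_polys J b d" "d \<le> d'"
  shows "x \<in> rat_polys J b d'"
proof -
  obtain r where "x = (\<Sum>m\<in>exps J d. of_rat (r m) * mon J b m)"
    using assms unfolding rat_polys_def by blast
  moreover have "exps J d \<subseteq> exps J d'"
    using assms(2) by (auto simp: exps_def PiE_iff intro: order_trans)
  ultimately show ?thesis
    by (auto intro!: rat_polys_sum rat_polys_monomial)
qed

lemma rat_polys_mult:
  assumes "x \<in> rat_polys J b d" "y \<in> rat_polys J b d'"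
  shows "x * y \<in> rat_polys J b (d + d')"
proof -
  obtain r s where xy: "x = (\<Sum>m\<in>exps J d. of_rat (r m) * mon J b m)"
    "y = (\<Sum>m\<in>exps J d'. of_rat (s m) * mon J b m)"
    using assms unfolding rat_polys_def by blast
  have "of_rat (r m) * mon J b m * (of_rat (s m') * mon J b m') \<in> rat_polys J b (d + d')"
    if "m \<in> exps J d" "m' \<in> exps J d'" for m m'
  proof -
    have "(\<lambda>j\<in>J. m j + m' j) \<in> exps J (d + d')"
      using that by (auto simp: exps_def PiE_iff intro: add_mono)
    moreover have "mon J b (\<lambda>j\<in>J. m j + m' j) = mon J b m * mon J b m'"
      by (simp add: mon_def power_add prod.distrib)
    ultimately show ?thesis
      using rat_polys_monomial[of "\<lambda>j\<in>J. m j + m' j" "d + d'" "r m * s m'"]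
      by (simp add: of_rat_mult mult_ac)
  qed
  then show ?thesis unfolding xy sum_product by (intro rat_polys_sum)
qed

lemma rat_polys_power: "x \<in> rat_polys J b d \<Longrightarrow> x ^ p \<in> rat_polys J b (p * d)"
proof (induction p)
  case 0
  then show ?case using rat_polys_const[of 1] by simp
next
  case (Suc p)
  then show ?case using rat_polys_mult[of x d "x ^ p" "p * d"] by simp
qed

lemma rat_polys_prod:
  assumes "finite X" "\<And>x. x \<in> X \<Longrightarrow> f x \<in> rat_polys J b d"
  shows "prod f X \<in> rat_polys J b (card X * d)"
  using assms
proof (induction X rule: finite_induct)
  case empty
  then show ?case using rat_polys_const[of 1] by simp
next
  case (insert x X)
  then show ?case using rat_polys_mult[of "f x" d "prod f X" "card X * d"] by simp
qed

lemma rat_polys_generator: "j \<in> J \<Longrightarrow> b j \<in> rat_polys J b 1"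
proof -
  assume j: "j \<in> J"
  have "mon J b (\<lambda>i\<in>J. if i = j then 1 else 0) = (\<Prod>i\<in>J. if i = j then b i else 1)"
    unfolding mon_def by (rule prod.cong) auto
  also have "\<dots> = b j" using j finJ by simp
  finally show ?thesis
    using rat_polys_monomial[of "\<lambda>i\<in>J. if i = j then 1 else 0" 1 1] j by (auto simp: exps_def)
qed

definition rat_ring :: "complex set" where
  "rat_ring = (\<Union>d. rat_polys J b d)"

lemma rat_ring_const: "of_rat q \<in> rat_ring"
  using rat_polys_const by (auto simp: rat_ring_def)

lemma rat_ring_generator: "j \<in> J \<Longrightarrow> b j \<in> rat_ring"
  using rat_polys_generator by (auto simp: rat_ring_def)

lemma rat_ring_mult: "x \<in> rat_ring \<Longrightarrow> y \<in> rat_ring \<Longrightarrow> x * y \<in> rat_ring"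
  unfolding rat_ring_def by (blast intro: rat_polys_mult)

lemma rat_ring_add: "x \<in> rat_ring \<Longrightarrow> y \<in> rat_ring \<Longrightarrow> x + y \<in> rat_ring"
  unfolding rat_ring_def
  by (clarsimp, meson rat_polys_add rat_polys_mono max.cobounded1 max.cobounded2)

lemma rat_ring_diff: "x \<in> rat_ring \<Longrightarrow> y \<in> rat_ring \<Longrightarrow> x - y \<in> rat_ring"
  using rat_ring_add[of x "of_rat (-1) * y"] rat_ring_mult[OF rat_ring_const, of y "-1"]
  by (simp add: of_rat_minus)

lemma rat_ring_sum: "(\<And>x. x \<in> X \<Longrightarrow> f x \<in> rat_ring) \<Longrightarrow> sum f X \<in> rat_ring"
proof (induction X rule: infinite_finite_induct)
  case (insert x X)
  then show ?case by (simp add: rat_ring_add)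
qed (use rat_ring_const[of 0] in auto)

lemma rat_ring_prod: "(\<And>x. x \<in> X \<Longrightarrow> f x \<in> rat_ring) \<Longrightarrow> prod f X \<in> rat_ring"
proof (induction X rule: infinite_finite_induct)
  case (insert x X)
  then show ?case by (simp add: rat_ring_mult)
qed (use rat_ring_const[of 1] in auto)

lemma rat_ring_common_degree:
  assumes "finite X" "\<And>x. x \<in> X \<Longrightarrow> f x \<in> rat_ring"
  shows "\<exists>d. \<forall>x\<in>X. f x \<in> rat_polys J b d"
proof -
  have "\<forall>x\<in>X. \<exists>d. f x \<in> rat_polys J b d" using assms by (auto simp: rat_ring_def)
  then obtain d where d: "\<forall>x\<in>X. f x \<in> rat_polys J b (d x)" by metis
  have "f x \<in> rat_polys J b (sum d X)" if "x \<in> X" for x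
    using rat_polys_mono[of "f x" "d x" "sum d X"] d that assms(1) member_le_sum[of x X d] by auto
  then show ?thesis by blast
qed

text \<open>
  Transcendence degree by counting monomials: up to degree \<open>D\<close> in each variable there are
  \<open>(D + 1) ^ card I\<close> monomials in \<open>a\<close>; after clearing denominators they lie in a rational vector
  space of dimension \<open>O(D ^ card J)\<close>.
\<close>

lemma alg_indep_card_le:
  fixes a :: "'i \<Rightarrow> real"
  assumes finI: "finite I" and indep: "alg_indep I a"
    and h: "h \<noteq> 0" "h \<in> rat_ring"
    and ah: "\<And>e. e \<in> I \<Longrightarrow> of_real (a e) * h \<in> rat_ring"
  shows "card I \<le> card J"
proof (rule ccontr)
  assume "\<not> card I \<le> card J"
  then have less: "card J < card I" by simp
  obtain d1 where d1: "\<forall>e\<in>I. of_real (a e) * h \<in> rat_polys J b d1"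
    using rat_ring_common_degree[OF finI, of "\<lambda>e. of_real (a e) * h"] ah by blast
  obtain d2 where d2: "h \<in> rat_polys J b d2" using h by (auto simp: rat_ring_def)
  define d where "d = max d1 d2"
  have ad: "of_real (a e) * h \<in> rat_polys J b d" if "e \<in> I" for e
    using d1 that rat_polys_mono by (auto simp: d_def)
  have hd: "h \<in> rat_polys J b d"
    using d2 rat_polys_mono by (auto simp: d_def)
  define N where "N = card I"
  \<comment> \<open>Clearing denominators leaves degree at most \<open>P\<close>, and
    \<open>P + 1 \<le> (N * d + 1) * (D + 1)\<close>. So the count needs
    \<open>(N * d + 1) ^ (N - 1) < D + 1\<close>, which this choice makes true.\<close>
  define D where "D = (N * d + 1) ^ (N - 1)"
  define P where "P = N * (D * d)"
  \<comment> \<open>Each variable gets \<open>D\<close> copies of \<open>h\<close>: as many as its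
    exponent clear its denominators, the rest remain as powers of \<open>h\<close>.\<close>
  have mem: "h ^ (N * D) * of_real (mon I a m) \<in> rat_polys J b P" if m: "m \<in> exps I D" for m
  proof -
    have le: "m e \<le> D" if "e \<in> I" for e using m that by (auto simp: exps_def)
    have "h ^ (N * D) = (\<Prod>e\<in>I. h ^ D)" by (simp add: N_def mult.commute power_mult)
    then have "h ^ (N * D) * of_real (mon I a m) = (\<Prod>e\<in>I. h ^ D * of_real (a e) ^ m e)"
      by (simp add: mon_def prod.distrib)
    also have "\<dots> = (\<Prod>e\<in>I. (of_real (a e) * h) ^ m e * h ^ (D - m e))"
    proof (rule prod.cong[OF refl])
      fix e assume "e \<in> I"
      then have "h ^ D = h ^ m e * h ^ (D - m e)" using le by (simp flip: power_add)
      then show "h ^ D * of_real (a e) ^ m e = (of_real (a e) * h) ^ m e * h ^ (D - m e)"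
        by (simp add: power_mult_distrib mult_ac)
    qed
    also have "\<dots> \<in> rat_polys J b P"
      unfolding P_def N_def
    proof (rule rat_polys_prod[OF finI])
      fix e assume e: "e \<in> I"
      have "(of_real (a e) * h) ^ m e * h ^ (D - m e) \<in> rat_polys J b (m e * d + (D - m e) * d)"
        by (intro rat_polys_mult rat_polys_power ad hd e)
      also have "m e * d + (D - m e) * d = D * d"
        using le[OF e] by (simp flip: add_mult_distrib)
      finally show "(of_real (a e) * h) ^ m e * h ^ (D - m e) \<in> rat_polys J b (D * d)" .
    qed
    finally show ?thesis .
  qed
  then have "\<forall>m\<in>exps I D. \<exists>r. h ^ (N * D) * of_real (mon I a m) =
      (\<Sum>m'\<in>exps J P. of_rat (r m') * mon J b m')"
    unfolding rat_polys_def by blast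
  then obtain r where r: "\<And>m. m \<in> exps I D \<Longrightarrow> h ^ (N * D) * of_real (mon I a m) =
      (\<Sum>m'\<in>exps J P. of_rat (r m m') * mon J b m')"
    by metis
  have "card (exps J P) < card (exps I D)"
  proof -
    have "P + 1 \<le> (N * d + 1) * (D + 1)" by (simp add: P_def algebra_simps)
    then have "(P + 1) ^ card J \<le> ((N * d + 1) * (D + 1)) ^ card J" by (rule power_mono) simp
    also have "\<dots> \<le> ((N * d + 1) * (D + 1)) ^ (N - 1)"
      using less by (intro power_increasing) (auto simp: N_def)
    also have "\<dots> = D * (D + 1) ^ (N - 1)" by (simp only: power_mult_distrib D_def)
    also have "\<dots> < (D + 1) * (D + 1) ^ (N - 1)" by (intro mult_strict_right_mono) auto
    also have "\<dots> = (D + 1) ^ N" using less by (simp add: N_def flip: power_Suc)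
    finally show ?thesis by (simp add: card_exps finI finJ N_def)
  qed
  \<comment> \<open>The unknowns are the coefficients of a polynomial in \<open>a\<close>, with one
    equation for each monomial in \<open>b\<close>. A solution is a rational relation between the
    \<open>a e\<close>.\<close>
  from homogeneous_system_nontrivial_solution[OF finite_exps[OF finI] finite_exps[OF finJ] this, of r]
  obtain w where w: "\<exists>m\<in>exps I D. w m \<noteq> 0"
    "\<And>m'. m' \<in> exps J P \<Longrightarrow> (\<Sum>m\<in>exps I D. w m * r m m') = 0" by blast
  have "h ^ (N * D) * of_real (\<Sum>m\<in>exps I D. of_rat (w m) * mon I a m) =
      (\<Sum>m\<in>exps I D. of_rat (w m) * (h ^ (N * D) * of_real (mon I a m)))"
    by (simp add: sum_distrib_left complex_of_real_of_rat mult_ac)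
  also have "\<dots> = (\<Sum>m\<in>exps I D. \<Sum>m'\<in>exps J P. of_rat (w m * r m m') * mon J b m')"
    by (intro sum.cong refl) (simp add: r[unfolded mult.commute[of N D]] sum_distrib_left of_rat_mult mult_ac)
  also have "\<dots> = (\<Sum>m'\<in>exps J P. of_rat (\<Sum>m\<in>exps I D. w m * r m m') * mon J b m')"
    by (subst sum.swap) (simp add: of_rat_sum sum_distrib_right)
  also have "\<dots> = 0" by (simp add: w)
  finally have "(\<Sum>m\<in>exps I D. of_rat (w m) * mon I a m) = (0::real)"
    using h(1) by (simp only: mult_eq_0_iff power_eq_0_iff of_real_eq_0_iff) simp
  then show False using indep w(1) unfolding alg_indep_def by blast
qed

end

text \<open>With all loops present, these are free coordinates on \<open>consensus_space\<close>,
  since the row sums determine the diagonal. Pairs are row and column, the reverse of the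
  arc.\<close>

definition off_diag :: "'n pair_pre_digraph \<Rightarrow> ('n \<times> 'n) set" where
  "off_diag G = {(i, l). i \<noteq> l \<and> (l, i) \<in> parcs G}"

text \<open>
  Each equation determines the entry \<open>(i, p i)\<close> from the other entries, \<open>z\<close> and the values of \<open>v\<close>,
  so a matrix with algebraically independent entries cannot satisfy more of them than there are
  irrational values.
\<close>

lemma card_mixed_rows_le:
  fixes v :: "'n::finite \<Rightarrow> complex" and a :: "'n \<times> 'n \<Rightarrow> real"
  assumes indep: "alg_indep (off_diag G) a"
    and eq: "\<And>i. i \<in> T \<Longrightarrow> (\<Sum>l | (i, l) \<in> off_diag G. of_real (a (i, l)) * (v l - v i)) = (z - 1) * v i"
    and mixed: "\<And>i. i \<in> T \<Longrightarrow> \<exists>l. (i, l) \<in> off_diag G \<and> v l \<noteq> v i"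
    and W: "finite W" "insert z (range v) \<subseteq> W \<union> range of_rat"
  shows "card T \<le> card W"
proof -
  obtain p where p: "\<And>i. i \<in> T \<Longrightarrow> (i, p i) \<in> off_diag G" "\<And>i. i \<in> T \<Longrightarrow> v (p i) \<noteq> v i"
    using mixed by metis
  define I where "I = off_diag G"
  define P where "P = (\<lambda>i. (i, p i)) ` T"
  have P: "P \<subseteq> I" "card P = card T" "finite I"
    using p by (auto simp: P_def I_def card_image inj_on_def)
  \<comment> \<open>The generators are the entries that are not solved for and the values in
    \<open>W\<close>. One entry per row of \<open>T\<close> is thus traded for \<open>W\<close>, so
    independence forces the bound.\<close>
  define J where "J = Inl ` (I - P) \<union> Inr ` W"
  define b where "b = case_sum (\<lambda>e. complex_of_real (a e)) (\<lambda>w. w)"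
  have J: "finite J" "card J = card I - card P + card W"
  proof -
    show "finite J" using P W by (simp add: J_def)
    have "card J = card (I - P) + card W"
      unfolding J_def using P W by (subst card_Un_disjoint) (auto simp: card_image)
    then show "card J = card I - card P + card W"
      using P by (simp add: card_Diff_subset finite_subset)
  qed
  note ring = rat_ring_const[OF J(1), where b = b] rat_ring_mult[OF J(1), of _ b]
    rat_ring_add[OF J(1), of _ b] rat_ring_diff[OF J(1), of _ b]
  have W_ring: "w \<in> rat_ring J b" if "w \<in> W" for w
    using rat_ring_generator[OF J(1), of "Inr w" b] that by (simp add: J_def b_def)
  have a_ring: "of_real (a e) \<in> rat_ring J b" if "e \<in> I - P" for e
    using rat_ring_generator[OF J(1), of "Inl e" b] that by (simp add: J_def b_def)
  have "w \<in> rat_ring J b" if "w \<in> insert z (range v)" for w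
    using subsetD[OF W(2) that] W_ring ring(1) by (elim UnE rangeE) simp_all
  then have v_ring: "v i \<in> rat_ring J b" and z_ring: "z \<in> rat_ring J b" for i
    by simp_all
  have one: "1 \<in> rat_ring J b" using ring(1)[of 1] by simp
  \<comment> \<open>Solving row \<open>i\<close> for its entry divides by
    \<open>v (p i) - v i\<close>; the product is a denominator common to all rows.\<close>
  define h where "h = (\<Prod>i\<in>T. v (p i) - v i)"
  have h: "h \<noteq> 0" "h \<in> rat_ring J b"
    using p(2) by (simp add: h_def) (unfold h_def, intro rat_ring_prod[OF J(1)] ring v_ring)
  have "of_real (a e) * h \<in> rat_ring J b" if e: "e \<in> I" for e
  proof (cases "e \<in> P")
    case False
    then show ?thesis using e by (intro ring h a_ring) auto
  next
    case True
    then obtain i where i: "i \<in> T" "e = (i, p i)" by (auto simp: P_def)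
    define Q where "Q = {l. (i, l) \<in> I} - {p i}"
    have "(\<Sum>l | (i, l) \<in> I. of_real (a (i, l)) * (v l - v i)) =
        of_real (a e) * (v (p i) - v i) + (\<Sum>l\<in>Q. of_real (a (i, l)) * (v l - v i))"
      unfolding Q_def i(2) by (rule sum.remove) (use p i in \<open>auto simp: I_def\<close>)
    then have "of_real (a e) * (v (p i) - v i) =
        (z - 1) * v i - (\<Sum>l\<in>Q. of_real (a (i, l)) * (v l - v i))"
      using eq[OF i(1)] by (simp add: I_def)
    also have "\<dots> \<in> rat_ring J b"
      by (intro ring rat_ring_sum[OF J(1)] v_ring z_ring one a_ring)
        (auto simp: Q_def P_def)
    finally have "of_real (a e) * (v (p i) - v i) \<in> rat_ring J b" .
    moreover have "(\<Prod>i'\<in>T - {i}. v (p i') - v i') \<in> rat_ring J b"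
      by (intro rat_ring_prod[OF J(1)] ring v_ring)
    moreover have "of_real (a e) * h =
        of_real (a e) * (v (p i) - v i) * (\<Prod>i'\<in>T - {i}. v (p i') - v i')"
      using prod.remove[of T i "\<lambda>i. v (p i) - v i"] i(1) by (simp add: h_def mult.assoc)
    ultimately show ?thesis by (simp only: ring(2))
  qed
  from alg_indep_card_le[OF J(1) P(3) indep[folded I_def] h this]
  show ?thesis
    using card_mono[OF P(3) P(1)] P(2) J(2) by linarith
qed

section \<open>Connectivity\<close>

text \<open>The form of connectivity that the counting uses. A complete graph has no such
  \<open>X\<close> and \<open>Y\<close>; otherwise the vertices outside both form a cutset.\<close>

definition separated :: "nat \<Rightarrow> 'n::finite pair_pre_digraph \<Rightarrow> bool" where
  "separated k G \<longleftrightarrow> (\<forall>X Y. X \<noteq> {} \<longrightarrow> Y \<noteq> {} \<longrightarrow> X \<inter> Y = {} \<longrightarrow>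
     (\<forall>x\<in>X. \<forall>y\<in>Y. (x, y) \<notin> parcs G) \<longrightarrow> k \<le> card (UNIV - X - Y))"

lemma k_connected_separated:
  fixes G :: "'n::finite pair_pre_digraph"
  assumes V: "pverts G = UNIV" and k: "k_connected k (with_proj G)"
  shows "separated k G"
  unfolding separated_def
proof (intro allI impI)
  fix X Y :: "'n set"
  assume XY: "X \<noteq> {}" "Y \<noteq> {}" "X \<inter> Y = {}" and no: "\<forall>x\<in>X. \<forall>y\<in>Y. (x, y) \<notin> parcs G"
  obtain x y where xy: "x \<in> X" "y \<in> Y" using XY by blast
  define S where "S = UNIV - X - Y"
  have incomplete: "\<not> complete_graph (with_proj G)"
  proof
    assume "complete_graph (with_proj G)"
    moreover have "x \<noteq> y" using xy XY(3) by blast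
    ultimately have "(x, y) \<in> parcs G" using V by (simp add: complete_graph_def)
    then show False using no xy by blast
  qed
  let ?H = "with_proj G \<restriction> (verts (with_proj G) - S)"
  have stay: "w \<in> X" if "u \<rightarrow>\<^sup>*\<^bsub>?H\<^esub> w" "u \<in> X" for u w
    using that
    unfolding reachable_def
  proof (induction rule: rtrancl_on.induct)
    case (rtrancl_on_into_rtrancl_on u v w)
    then have "(v, w) \<in> parcs G" "w \<notin> S"
      by (auto simp: induce_subgraph_def arcs_ends_def arc_to_ends_def)
    then show ?case using rtrancl_on_into_rtrancl_on no by (auto simp: S_def)
  qed
  have "\<not> x \<rightarrow>\<^sup>*\<^bsub>?H\<^esub> y" using stay xy XY by blast
  then have "vertex_cutset (with_proj G) S"
    using xy V by (auto simp: vertex_cutset_def strongly_connected_def S_def)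
  then have "Min (card ` {S. vertex_cutset (with_proj G) S}) \<le> card S"
    by (intro Min_le) auto
  then show "k \<le> card (UNIV - X - Y)"
    using k incomplete by (simp add: k_connected_def vertex_connectivity_def S_def)
qed

definition out_nbrs :: "'n pair_pre_digraph \<Rightarrow> 'n set \<Rightarrow> 'n set" where
  "out_nbrs G S = {i. \<exists>l\<in>S. (l, i) \<in> parcs G}"

text \<open>Connectivity is applied to \<open>S\<close> and the complement of its out-neighbors,
  which is nonempty because of \<open>j\<close>; the loops place \<open>S\<close> among its
  out-neighbors.\<close>

lemma card_out_nbrs_ge:
  fixes G :: "'n::finite pair_pre_digraph"
  assumes sep: "separated k G" and refl: "\<And>i. (i, i) \<in> parcs G"
    and S: "S \<noteq> {}" "j \<notin> out_nbrs G S"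
  shows "card S + k \<le> card (out_nbrs G S)"
proof -
  have sub: "S \<subseteq> out_nbrs G S" using refl by (auto simp: out_nbrs_def)
  have "k \<le> card (UNIV - S - (UNIV - out_nbrs G S))"
    using S sub by (intro sep[unfolded separated_def, rule_format]) (auto simp: out_nbrs_def)
  also have "UNIV - S - (UNIV - out_nbrs G S) = out_nbrs G S - S" by auto
  also have "card \<dots> = card (out_nbrs G S) - card S" by (simp add: card_Diff_subset sub)
  finally show ?thesis using card_mono[OF _ sub] by simp
qed

section \<open>Modes and state sequences\<close>

lemma row_equation_off_diag:
  fixes A :: "real ^ 'n ^ 'n" and v :: "'n \<Rightarrow> complex"
  assumes A: "A \<in> consensus_space (with_proj G)"
    and eq: "(\<Sum>l\<in>UNIV. of_real (A $ i $ l) * v l) = z * v i"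
  shows "(\<Sum>l | (i, l) \<in> off_diag G. of_real (A $ i $ l) * (v l - v i)) = (z - 1) * v i"
proof -
  have zero: "of_real (A $ i $ l) * (v l - v i) = 0" if "(i, l) \<notin> off_diag G" for l
    using that A by (cases "i = l") (auto simp: off_diag_def consensus_space_def)
  have "(\<Sum>l | (i, l) \<in> off_diag G. of_real (A $ i $ l) * (v l - v i)) =
      (\<Sum>l\<in>UNIV. of_real (A $ i $ l) * (v l - v i))"
    using zero by (intro sum.mono_neutral_left) auto
  also have "\<dots> = (\<Sum>l\<in>UNIV. of_real (A $ i $ l) * v l) - of_real (\<Sum>l\<in>UNIV. A $ i $ l) * v i"
    by (simp add: right_diff_distrib sum_subtractf sum_distrib_right)
  also have "(\<Sum>l\<in>UNIV. A $ i $ l) = 1"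
    using A by (simp add: consensus_space_def)
  finally show ?thesis using eq by (simp add: algebra_simps)
qed

text \<open>Scaling gives the mode the value 1; this and 0 are rational, so at most
  \<open>card S - 1\<close> of its values count in \<open>card_mixed_rows_le\<close>, with at most
  one more for \<open>z\<close>. For \<open>z = 1\<close> a row that is constant on its in-neighbors
  is no contradiction, and the level sets of the mode are counted instead.\<close>

lemma mode_vanishes:
  fixes G :: "'n::finite pair_pre_digraph" and A :: "real ^ 'n ^ 'n" and v :: "'n \<Rightarrow> complex"
  assumes sep: "separated k G" and refl: "\<And>i. (i, i) \<in> parcs G"
    and A: "A \<in> consensus_space (with_proj G)" "alg_indep (off_diag G) (\<lambda>(i, l). A $ i $ l)"
    and eq: "\<And>i. i \<notin> K \<Longrightarrow> (\<Sum>l\<in>UNIV. of_real (A $ i $ l) * v l) = z * v i"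
    and out: "\<And>i. (i, j) \<in> parcs G \<Longrightarrow> v i = 0"
    and K: "card K < k \<or> card K \<le> k \<and> z \<in> range of_rat \<and> z \<noteq> 1"
  shows "v i = 0"
proof (rule ccontr)
  assume nz: "v i \<noteq> 0"
  define v1 where "v1 l = v l / v i" for l
  define S where "S = {l. v1 l \<noteq> 0}"
  define M where "M = {i. \<exists>l. (i, l) \<in> off_diag G \<and> v1 l \<noteq> v1 i}"
  define T where "T = M - K"
  have i: "i \<in> S" "v1 i = 1" using nz by (auto simp: S_def v1_def)
  have v1j: "v1 j = 0" using out[OF refl] by (simp add: v1_def)
  have eq1: "(\<Sum>l | (r, l) \<in> off_diag G. of_real (A $ r $ l) * (v1 l - v1 r)) = (z - 1) * v1 r"
    if "r \<notin> K" for r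
    by (rule row_equation_off_diag[OF A(1)])
      (use eq[OF that] in \<open>simp add: v1_def sum_divide_distrib[symmetric]\<close>)
  have T_le: "card T \<le> card W" if "finite W" "insert z (range v1) \<subseteq> W \<union> range of_rat" for W
    by (rule card_mixed_rows_le[OF A(2) _ _ that]) (use eq1 in \<open>auto simp: T_def M_def\<close>)
  have rat01: "(0::complex) \<in> range of_rat" "(1::complex) \<in> range of_rat"
    using rangeI[of "of_rat :: rat \<Rightarrow> complex" 0] rangeI[of "of_rat :: rat \<Rightarrow> complex" 1] by simp_all
  have v1_range: "range v1 \<subseteq> (v1 ` S - {1}) \<union> range of_rat"
  proof
    fix y assume "y \<in> range v1"
    then obtain l where "y = v1 l" by blast
    then show "y \<in> (v1 ` S - {1}) \<union> range of_rat"
      using rat01 by (cases "y = 0 \<or> y = 1") (auto simp: S_def)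
  qed
  have q: "card (v1 ` S - {1}) = card (v1 ` S) - 1" "card (v1 ` S) > 0" "card (v1 ` S) \<le> card S"
    using i by (force simp: card_gt_0_iff card_image_le)+
  have "j \<notin> out_nbrs G S"
    using out by (auto simp: out_nbrs_def S_def v1_def)
  then have hall: "card S + k \<le> card (out_nbrs G S)"
    using card_out_nbrs_ge[OF sep refl] i by blast
  have "card S + k - card K \<le> card (out_nbrs G S - K)"
    using hall diff_card_le_card_Diff[of K "out_nbrs G S"] by simp
  then have hall_T: "card S + k - card K \<le> card T" if "out_nbrs G S - K \<subseteq> M"
  proof -
    have "out_nbrs G S - K \<subseteq> T" using that by (auto simp: T_def)
    then have "card (out_nbrs G S - K) \<le> card T" by (intro card_mono) auto
    then show ?thesis using \<open>card S + k - card K \<le> card (out_nbrs G S - K)\<close> by simp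
  qed
  show False
  proof (cases "z = 1")
    case False
    \<comment> \<open>If row \<open>r\<close> is constant on its in-neighbors, its equation gives
      the value 0 at \<open>r\<close> and hence at all of them, but one of them lies in
      \<open>S\<close>.\<close>
    have "out_nbrs G S - K \<subseteq> M"
    proof
      fix r assume r: "r \<in> out_nbrs G S - K"
      show "r \<in> M"
      proof (rule ccontr)
        assume "r \<notin> M"
        then have const: "v1 l = v1 r" if "(r, l) \<in> off_diag G" for l
          using that by (auto simp: M_def)
        have "(z - 1) * v1 r = 0" using eq1[of r] r const by simp
        then have "v1 r = 0" using False by simp
        then show False using r const by (force simp: out_nbrs_def S_def off_diag_def)
      qed
    qed
    note T_ge = hall_T[OF this]
    show False
    proof (cases "card K < k")
      case True
      have "card T \<le> card (insert z (v1 ` S - {1}))"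
        using v1_range by (intro T_le) auto
      also have "\<dots> \<le> Suc (card (v1 ` S - {1}))" by (simp add: card_insert_if)
      finally show False using T_ge q True by linarith
    next
      case False
      then have "card T \<le> card (v1 ` S - {1})"
        using v1_range K by (intro T_le) auto
      then show False using T_ge q K False by linarith
    qed
  next
    case True
    then have K': "card K < k" using K by simp
    have "card T \<le> card (v1 ` S - {1})"
      using v1_range rat01 True by (intro T_le) auto
    then have T_less: "card T < card (v1 ` S)" using q by linarith
    define C where "C c = {l. v1 l = c}" for c
    \<comment> \<open>The vertices of a level set outside \<open>M\<close> have in-neighbors only
      within it. So those in \<open>M\<close> separate them from the complement, which contains
      \<open>j\<close>.\<close>
    have big: "C c \<subseteq> M \<or> k \<le> card (C c \<inter> M)" if c: "c \<in> v1 ` S" for c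
    proof (cases "C c \<subseteq> M")
      case False
      have "j \<notin> C c" using v1j c by (auto simp: C_def S_def)
      then have "k \<le> card (UNIV - (UNIV - C c) - (C c - M))"
        using False by (intro sep[unfolded separated_def, rule_format])
          (auto simp: C_def M_def off_diag_def)
      also have "UNIV - (UNIV - C c) - (C c - M) = C c \<inter> M" by auto
      finally show ?thesis by simp
    qed simp
    show False
    proof (cases "\<forall>c\<in>v1 ` S. C c \<subseteq> M")
      case True
      then have "S \<subseteq> M" by (auto simp: C_def)
      moreover have "r \<in> M" if "r \<in> out_nbrs G S" "r \<notin> S" for r
        using that by (force simp: out_nbrs_def M_def S_def off_diag_def)
      ultimately have "card S + k - card K \<le> card T" by (intro hall_T) blast
      then show False using T_less q K' by linarith
    next
      case False
      \<comment> \<open>One level set contributes at least \<open>k\<close> vertices of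
        \<open>M\<close> and every other one at least one. Fewer than \<open>k\<close> of them lie
        in \<open>K\<close>, so at least as many rows as values remain, contradicting
        \<open>T_less\<close>.\<close>
      then obtain c0 where c0: "c0 \<in> v1 ` S" "k \<le> card (C c0 \<inter> M)" using big by blast
      have "1 \<le> card (C c \<inter> M)" if "c \<in> v1 ` S" for c
      proof (cases "C c \<subseteq> M")
        case True
        moreover have "C c \<noteq> {}" using that by (auto simp: C_def)
        ultimately have "card (C c \<inter> M) > 0" by (subst card_gt_0_iff) auto
        then show ?thesis by simp
      next
        case False
        then show ?thesis using big[OF that] K' by linarith
      qed
      then have "(\<Sum>c\<in>v1 ` S - {c0}. 1) \<le> (\<Sum>c\<in>v1 ` S - {c0}. card (C c \<inter> M))"
        by (intro sum_mono) auto
      then have "k + (card (v1 ` S) - 1) \<le> card (C c0 \<inter> M) + (\<Sum>c\<in>v1 ` S - {c0}. card (C c \<inter> M))"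
        using c0 by (simp add: card_Diff_singleton)
      also have "\<dots> = (\<Sum>c\<in>v1 ` S. card (C c \<inter> M))"
        using c0(1) by (subst sum.remove[of "v1 ` S" c0]) auto
      also have "\<dots> = card (\<Union>c\<in>v1 ` S. C c \<inter> M)"
        by (rule card_UN_disjoint[symmetric]) (auto simp: C_def)
      also have "\<dots> \<le> card M" by (intro card_mono) auto
      finally have "k + (card (v1 ` S) - 1) - card K \<le> card T"
        using diff_card_le_card_Diff[of K M] unfolding T_def by simp
      then show False using T_less q K' by linarith
    qed
  qed
qed

lemma zero_output_trajectory_vanishes:
  fixes G :: "'n::finite pair_pre_digraph" and A :: "real ^ 'n ^ 'n" and x :: "nat \<Rightarrow> 'n \<Rightarrow> real"
  assumes sep: "separated k G" and refl: "\<And>i. (i, i) \<in> parcs G"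
    and A: "A \<in> consensus_space (with_proj G)" "alg_indep (off_diag G) (\<lambda>(i, l). A $ i $ l)"
    and step: "\<And>t i. i \<notin> K \<Longrightarrow> x (Suc t) i = (\<Sum>l\<in>UNIV. A $ i $ l * x t l)"
    and out: "\<And>t i. (i, j) \<in> parcs G \<Longrightarrow> x t i = 0"
    and K: "card K < k"
  shows "x t i = 0"
proof (rule ccontr)
  assume nz: "x t i \<noteq> 0"
  \<comment> \<open>Starting the clock at a nonzero state ensures that no nonzero constant
    polynomial annihilates the sequence.\<close>
  define y where "y s l = complex_of_real (x (t + s) l)" for s l
  define E where "E p l = (\<Sum>s\<le>degree p. coeff p s * y s l)" for p l
  define ann where "ann p \<longleftrightarrow> p \<noteq> 0 \<and> (\<forall>l. E p l = 0)" for p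
  have "\<exists>p. ann p"
  proof -
    have "card (UNIV :: 'n set) < card {..CARD('n)}" by simp
    from homogeneous_system_nontrivial_solution[OF _ _ this, of y] obtain w s where
      w: "s \<le> CARD('n)" "w s \<noteq> 0" "\<And>l. (\<Sum>s\<le>CARD('n). w s * y s l) = 0" by auto
    define p where "p = (\<Sum>s\<le>CARD('n). monom (w s) s)"
    have cp: "coeff p s = (if s \<le> CARD('n) then w s else 0)" for s
      by (simp add: p_def coeff_sum)
    have "degree p \<le> CARD('n)" by (rule degree_le) (simp add: cp)
    then have "E p l = (\<Sum>s\<le>CARD('n). coeff p s * y s l)" for l
      unfolding E_def by (intro sum.mono_neutral_left) (auto simp: coeff_eq_0)
    then have "E p l = 0" for l using w(3) by (simp add: cp)
    moreover have "p \<noteq> 0" using cp[of s] w by auto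
    ultimately show ?thesis by (auto simp: ann_def)
  qed
  then obtain p where p: "ann p" "\<And>q. ann q \<Longrightarrow> degree p \<le> degree q"
    using ex_has_least_nat[of ann _ degree] by blast
  have "degree p \<noteq> 0"
  proof
    assume "degree p = 0"
    then obtain c where "p = [:c:]" by (metis degree_eq_zeroE)
    then have "c \<noteq> 0" "E p i = c * y 0 i" using p(1) by (auto simp: ann_def E_def)
    then show False using p(1) nz by (simp add: ann_def y_def)
  qed
  then have "\<not> constant (poly p)" by (simp add: constant_degree)
  then obtain z where "poly p z = 0" using fundamental_theorem_of_algebra by blast
  then obtain q where q: "p = [:- z, 1:] * q" by (auto simp: poly_eq_0_iff_dvd)
  have q0: "q \<noteq> 0" using p(1) q by (auto simp: ann_def)
  have deg: "degree p = Suc (degree q)" unfolding q using q0 by (subst degree_mult_eq) auto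
  have coeffs: "coeff p 0 = - z * coeff q 0" "coeff p (Suc s) = coeff q s - z * coeff q (Suc s)" for s
    by (simp_all add: q)
  \<comment> \<open>By the coefficients of \<open>p = [:- z, 1:] * q\<close> and
    \<open>E p l = 0\<close>, advancing time by one step multiplies \<open>E q\<close> by
    \<open>z\<close>; this yields the mode equation.\<close>
  have shift: "(\<Sum>s\<le>degree q. coeff q s * y (Suc s) l) = z * E q l" for l
  proof -
    have "E p l = - z * coeff q 0 * y 0 l + (\<Sum>s\<le>degree q. (coeff q s - z * coeff q (Suc s)) * y (Suc s) l)"
      unfolding E_def deg by (simp only: sum.atMost_Suc_shift coeffs)
    also have "\<dots> = (\<Sum>s\<le>degree q. coeff q s * y (Suc s) l) -
        z * (coeff q 0 * y 0 l + (\<Sum>s\<le>degree q. coeff q (Suc s) * y (Suc s) l))"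
      by (simp add: algebra_simps sum_subtractf sum_distrib_left)
    also have "coeff q 0 * y 0 l + (\<Sum>s\<le>degree q. coeff q (Suc s) * y (Suc s) l) =
        (\<Sum>s\<le>Suc (degree q). coeff q s * y s l)"
      by (simp only: sum.atMost_Suc_shift)
    also have "\<dots> = E q l" by (simp add: E_def coeff_eq_0)
    finally show ?thesis using p(1) by (simp add: ann_def)
  qed
  have "E q l = 0" for l
  proof (rule mode_vanishes[OF sep refl A, of K "E q" z j])
    fix r assume r: "r \<notin> K"
    have "(\<Sum>l\<in>UNIV. of_real (A $ r $ l) * E q l) =
        (\<Sum>s\<le>degree q. coeff q s * (\<Sum>l\<in>UNIV. of_real (A $ r $ l) * y s l))"
      unfolding E_def sum_distrib_left by (subst sum.swap) (simp add: mult_ac)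
    also have "\<dots> = (\<Sum>s\<le>degree q. coeff q s * y (Suc s) r)"
      using step[OF r] by (simp add: y_def)
    finally show "(\<Sum>l\<in>UNIV. of_real (A $ r $ l) * E q l) = z * E q r" using shift by simp
  qed (use out K in \<open>auto simp: E_def y_def\<close>)
  then have "ann q" using q0 by (simp add: ann_def)
  then show False using p(2) deg by fastforce
qed

lemma not_all_impulses_cancellable:
  fixes G :: "'n::finite pair_pre_digraph" and A :: "real ^ 'n ^ 'n"
    and x :: "nat \<Rightarrow> nat \<Rightarrow> 'n \<Rightarrow> real"
  assumes sep: "separated k G" and refl: "\<And>i. (i, i) \<in> parcs G"
    and A: "A \<in> consensus_space (with_proj G)" "alg_indep (off_diag G) (\<lambda>(i, l). A $ i $ l)"
    and step: "\<And>s t i. i \<notin> K \<Longrightarrow> x s (Suc t) i = (\<Sum>l\<in>UNIV. A $ i $ l * x s t l)"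
    and impulse: "\<And>s t. x s (Suc t) r = (\<Sum>l\<in>UNIV. A $ r $ l * x s t l) + (if t = s then 1 else 0)"
    and out: "\<And>s t i. (i, j) \<in> parcs G \<Longrightarrow> x s t i = 0"
    and K: "card K \<le> k"
  shows False
proof -
  \<comment> \<open>There are \<open>2 * CARD('n) + 1\<close> impulse times up to \<open>N\<close>,
    but only \<open>2 * CARD('n)\<close> conditions: the combined state is to vanish at times 0 and
    \<open>Suc N\<close>.\<close>
  define N where "N = 2 * CARD('n)"
  define Y where "Y = (UNIV :: 'n set) \<times> {0, Suc N}"
  have "card Y < card {..N}" by (simp add: Y_def N_def card_cartesian_product)
  from homogeneous_system_nontrivial_solution[OF _ _ this, of "\<lambda>s (l, t). x s t l"]
  obtain w s0 where w: "s0 \<le> N" "w s0 \<noteq> 0"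
    "\<And>l t. (l, t) \<in> Y \<Longrightarrow> (\<Sum>s\<le>N. w s * x s t l) = 0" by (fastforce simp: Y_def)
  define X where "X t l = (\<Sum>s\<le>N. w s * x s t l)" for t l
  have ends: "X 0 l = 0" "X (Suc N) l = 0" for l
    using w(3) by (auto simp: X_def Y_def)
  have lin: "(\<Sum>s\<le>N. w s * (\<Sum>l\<in>UNIV. A $ i $ l * x s t l)) = (\<Sum>l\<in>UNIV. A $ i $ l * X t l)" for i t
    unfolding X_def sum_distrib_left by (subst sum.swap) (simp add: mult_ac)
  have X_step: "X (Suc t) i = (\<Sum>l\<in>UNIV. A $ i $ l * X t l)" if "i \<notin> K" for t i
    using lin step[OF that] by (simp add: X_def)
  have X_impulse: "X (Suc t) r = (\<Sum>l\<in>UNIV. A $ r $ l * X t l) + w t" if "t \<le> N" for t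
  proof -
    have "X (Suc t) r = (\<Sum>l\<in>UNIV. A $ r $ l * X t l) + (\<Sum>s\<le>N. w s * (if t = s then 1 else 0))"
      unfolding X_def[of "Suc t"] impulse by (simp only: distrib_left sum.distrib lin)
    also have "(\<Sum>s\<le>N. w s * (if t = s then 1 else 0)) = (\<Sum>s\<le>N. if t = s then w s else 0)"
      by (rule sum.cong) auto
    finally show ?thesis using that by simp
  qed
  define V where "V z i = (\<Sum>t\<le>N. complex_of_real (X t i) * z ^ (N - t))" for z i
  have V0: "V z i = 0" if z: "z \<in> range of_rat" "z \<noteq> 1" for z i
  proof (rule mode_vanishes[OF sep refl A, of K "V z" z j])
    fix i assume i: "i \<notin> K"
    \<comment> \<open>As the states at times 0 and \<open>Suc N\<close> vanish, the sum of
      \<open>f\<close> can be shifted by one step; this turns applying row \<open>i\<close> of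
      \<open>A\<close> into multiplication by \<open>z\<close>.\<close>
    define f where "f t = complex_of_real (X t i) * z ^ (Suc N - t)" for t
    have "(\<Sum>l\<in>UNIV. of_real (A $ i $ l) * V z l) =
        (\<Sum>t\<le>N. of_real (\<Sum>l\<in>UNIV. A $ i $ l * X t l) * z ^ (N - t))"
      unfolding V_def sum_distrib_left of_real_sum sum_distrib_right
      by (subst sum.swap) (simp add: mult_ac)
    also have "\<dots> = (\<Sum>t\<le>N. f (Suc t))"
      using X_step[OF i] by (simp add: f_def)
    also have "\<dots> = (\<Sum>t\<le>Suc N. f t)"
      unfolding sum.atMost_Suc_shift by (simp add: f_def ends)
    also have "\<dots> = (\<Sum>t\<le>N. f t)" by (simp add: f_def ends)
    also have "\<dots> = z * V z i"
      unfolding V_def sum_distrib_left by (intro sum.cong) (auto simp: f_def Suc_diff_le)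
    finally show "(\<Sum>l\<in>UNIV. of_real (A $ i $ l) * V z l) = z * V z i" .
  next
    fix i assume "(i, j) \<in> parcs G"
    then show "V z i = 0" using out by (simp add: V_def X_def)
  qed (use K z in auto)
  \<comment> \<open>\<open>V z i\<close> is a polynomial in \<open>z\<close> with coefficients
    \<open>X t i\<close>, and it vanishes at infinitely many rationals.\<close>
  have X0: "X t i = 0" if "t \<le> N" for t i
  proof -
    define p where "p = (\<Sum>t\<le>N. monom (complex_of_real (X t i)) (N - t))"
    have "range of_rat - {1} \<subseteq> {z. poly p z = 0}"
      using V0[of _ i] by (auto simp: p_def V_def poly_sum poly_monom)
    moreover have "infinite (range (of_rat :: rat \<Rightarrow> complex) - {1})"
      by (simp add: finite_image_iff inj_on_def infinite_UNIV_char_0)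
    ultimately have "p = 0" using poly_roots_finite[of p] finite_subset by blast
    have "coeff p (N - t) = (\<Sum>t'\<le>N. if t' = t then complex_of_real (X t i) else 0)"
      unfolding p_def coeff_sum by (rule sum.cong) (use that in auto)
    then show ?thesis using that \<open>p = 0\<close> by simp
  qed
  \<comment> \<open>All states up to time \<open>Suc N\<close> vanish, so the impulse equation at
    time \<open>s0\<close> leaves only \<open>w s0\<close>.\<close>
  have "w s0 = 0"
    using X_impulse[OF w(1)] X0[OF w(1)] X0[of "Suc s0" r] ends(2) w(1)
    by (cases "s0 = N") auto
  then show False using w(2) by simp
qed

section \<open>Almost every matrix is algebraically independent\<close>

text \<open>Some coefficient with respect to the new variable is a nonzero polynomial in the others.
  Once these are fixed at a nonroot of it, a univariate polynomial with finitely many roots is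
  left.\<close>

lemma nonzero_polynomial_has_nonroot:
  fixes w :: "('i \<Rightarrow> nat) \<Rightarrow> real"
  assumes "finite I" "\<exists>m\<in>exps I D. w m \<noteq> 0"
  shows "\<exists>x. (\<Sum>m\<in>exps I D. w m * mon I x m) \<noteq> 0"
  using assms
proof (induction I arbitrary: w rule: finite_induct)
  case empty
  then show ?case by (auto simp: exps_def mon_def)
next
  case (insert e I)
  let ?f = "\<lambda>(k, m). m(e := k)"
  have split: "exps (insert e I) D = ?f ` ({..D} \<times> exps I D)"
    by (simp add: exps_def PiE_insert_eq)
  have inj: "inj_on ?f ({..D} \<times> exps I D)"
    unfolding exps_def by (rule inj_combinator[OF insert.hyps(2), of "\<lambda>_. {..D}"])
  obtain k m where km: "k \<le> D" "m \<in> exps I D" "w (m(e := k)) \<noteq> 0"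
    using insert.prems unfolding split by auto
  with insert.IH[of "\<lambda>m. w (m(e := k))"] obtain x where
    x: "(\<Sum>m\<in>exps I D. w (m(e := k)) * mon I x m) \<noteq> 0" by blast
  define c where "c k = (\<Sum>m\<in>exps I D. w (m(e := k)) * mon I x m)" for k
  define p where "p = (\<Sum>k\<le>D. monom (c k) k)"
  have "coeff p k = c k" using km by (simp add: p_def coeff_sum)
  then have "p \<noteq> 0" using x by (auto simp: c_def)
  then have "finite {t. poly p t = 0}" by (rule poly_roots_finite)
  then have "{t. poly p t = 0} \<noteq> UNIV" using infinite_UNIV_char_0 by metis
  then obtain t where t: "poly p t \<noteq> 0" by blast
  have mon: "mon (insert e I) (x(e := t)) (m(e := k)) = t ^ k * mon I x m" for m k
  proof -
    have "(\<Prod>i\<in>I. (x(e := t)) i ^ (m(e := k)) i) = mon I x m"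
      unfolding mon_def by (rule prod.cong) (use insert.hyps in auto)
    then show ?thesis using insert.hyps by (simp add: mon_def)
  qed
  have "(\<Sum>m\<in>exps (insert e I) D. w m * mon (insert e I) (x(e := t)) m) =
      (\<Sum>k\<le>D. \<Sum>m\<in>exps I D. w (m(e := k)) * (t ^ k * mon I x m))"
    unfolding split by (subst sum.reindex[OF inj]) (simp add: sum.cartesian_product mon split_def)
  also have "\<dots> = poly p t"
    by (simp add: p_def poly_sum poly_monom c_def sum_distrib_left mult_ac)
  finally show ?case using t by metis
qed

text \<open>Fubini and induction on the coordinates: by the slice through \<open>c0 b\<close>, the
  function is a nonzero polynomial on almost every line in direction \<open>b\<close>, so it has
  finitely many zeros there.\<close>

lemma AE_PiM_lborel_nonroot:
  fixes F :: "('b \<Rightarrow> real) \<Rightarrow> real"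
  assumes "finite B" "\<And>c b. \<exists>p. \<forall>t. F (c(b := t)) = poly p t"
    and "F \<in> borel_measurable (\<Pi>\<^sub>M b\<in>B. lborel)" "c0 \<in> extensional B" "F c0 \<noteq> 0"
  shows "AE c in (\<Pi>\<^sub>M b\<in>B. lborel). F c \<noteq> 0"
  using assms
proof (induction B arbitrary: F c0 rule: finite_induct)
  case empty
  then have "c0 = (\<lambda>_. undefined)" by (simp add: extensional_def fun_eq_iff)
  then show ?case using empty by (intro AE_I2) (simp add: space_PiM)
next
  case (insert b I)
  interpret product_sigma_finite "\<lambda>_. lborel :: real measure" ..
  let ?M = "\<lambda>J. \<Pi>\<^sub>M b\<in>J. (lborel :: real measure)"
  have upd: "(\<lambda>c. c(b := s)) \<in> ?M I \<rightarrow>\<^sub>M ?M (insert b I)" for s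
    by (rule measurable_fun_upd[where J = I]) auto
  have "AE c in ?M I. F (c(b := c0 b)) \<noteq> 0"
  proof (rule insert.IH)
    show "\<exists>p. \<forall>t. F ((c(b' := t))(b := c0 b)) = poly p t" for c b'
    proof (cases "b' = b")
      case True
      then show ?thesis by (intro exI[of _ "[:F (c(b := c0 b)):]"]) simp
    next
      case False
      then show ?thesis using insert.prems(1)[of "c(b := c0 b)" b']
        by (simp add: fun_upd_twist[of b b'] del: fun_upd_apply)
    qed
    show "(\<lambda>c. F (c(b := c0 b))) \<in> borel_measurable (?M I)"
      using measurable_compose[OF upd insert.prems(2)] .
    show "c0(b := undefined) \<in> extensional I"
      using insert.prems(3) by (auto simp: extensional_def)
    show "F ((c0(b := undefined))(b := c0 b)) \<noteq> 0" using insert.prems(4) by simp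
  qed
  moreover have "(\<integral>\<^sup>+t. indicator {0} (F (c(b := t))) \<partial>lborel) = (0::ennreal)"
    if "F (c(b := c0 b)) \<noteq> 0" for c
  proof -
    obtain p where p: "\<And>t. F (c(b := t)) = poly p t" using insert.prems(1) by blast
    have "p \<noteq> 0" using that p by auto
    then have "finite {t. poly p t = 0}" by (rule poly_roots_finite)
    then have "AE t in lborel. t \<notin> {t. poly p t = 0}"
      by (intro AE_not_in countable_imp_null_set_lborel countable_finite)
    then have "AE t in lborel. indicator {0} (F (c(b := t))) = (0::ennreal)"
      by eventually_elim (simp add: p)
    then show ?thesis using nn_integral_cong_AE by fastforce
  qed
  ultimately have "AE c in ?M I. (\<integral>\<^sup>+t. indicator {0} (F (c(b := t))) \<partial>lborel) = (0::ennreal)"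
    by (auto elim: eventually_mono)
  then have "(\<integral>\<^sup>+c. (\<integral>\<^sup>+t. indicator {0} (F (c(b := t))) \<partial>lborel) \<partial>?M I) = (\<integral>\<^sup>+c. 0 \<partial>?M I)"
    by (rule nn_integral_cong_AE)
  moreover have meas: "(\<lambda>c. indicator {0} (F c) :: ennreal) \<in> borel_measurable (?M (insert b I))"
    using insert.prems(2) by measurable
  ultimately have "(\<integral>\<^sup>+c. indicator {0} (F c) \<partial>?M (insert b I)) = 0"
    using product_nn_integral_insert[OF insert.hyps meas] by simp
  then have "AE c in ?M (insert b I). indicator {0} (F c) = (0::ennreal)"
    using nn_integral_0_iff_AE[OF meas] by simp
  then show ?case by eventually_elim (auto split: split_indicator_asm)
qed

text \<open>In the coordinates that define \<open>lborel_affine\<close>, coordinate lines become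
  lines of the affine space, so \<open>AE_PiM_lborel_nonroot\<close> applies; the point
  \<open>x\<close> supplies the nonroot.\<close>

lemma AE_lborel_affine_nonroot:
  fixes M :: "'a::euclidean_space set" and Q :: "'a \<Rightarrow> real"
  assumes M: "affine M"
    and line: "\<And>x y. \<exists>p. \<forall>t. Q (x + t *\<^sub>R y) = poly p t"
    and meas: "Q \<in> borel_measurable borel"
    and x: "x \<in> M" "Q x \<noteq> 0"
  shows "AE A in lborel_affine M. Q A \<noteq> 0"
proof -
  define a where "a = (SOME a. a \<in> M)"
  define U where "U = {x - y |x y. x \<in> M \<and> y \<in> M}"
  define B where "B = (SOME B. orthonormal_basis_of U B)"
  define f where "f c = a + (\<Sum>b\<in>B. c b *\<^sub>R b)" for c
  have a: "a \<in> M" unfolding a_def using x(1) by (rule someI)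
  have in_M: "a + (y - z) \<in> M" if "y \<in> M" "z \<in> M" for y z
    using mem_affine_3_minus[OF M a that, of 1] by simp
  have "U = {y - a |y. y \<in> M}"
  proof -
    have "\<exists>w. y - z = w - a \<and> w \<in> M" if "y \<in> M" "z \<in> M" for y z
      using in_M[OF that] by (intro exI[of _ "a + (y - z)"]) simp
    then show ?thesis using a by (auto simp: U_def)
  qed
  then have U: "subspace U" using affine_diffs_subspace_subtract[OF M a] by (simp add: image_def Bex_def conj_commute)
  have "\<exists>B. orthonormal_basis_of U B"
    using orthonormal_basis_subspace[OF U] unfolding orthonormal_basis_of_def by metis
  then have "orthonormal_basis_of U B" unfolding B_def by (rule someI_ex)
  then have B: "pairwise orthogonal B" "\<And>b. b \<in> B \<Longrightarrow> norm b = 1" "span B = U"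
    by (auto simp: orthonormal_basis_of_def)
  have finB: "finite B"
    using pairwise_orthogonal_independent[OF B(1)] B(2) by (force dest: independent_imp_finite)
  have f_M: "f c \<in> M" for c
  proof -
    have "(\<Sum>b\<in>B. c b *\<^sub>R b) \<in> U"
      unfolding B(3)[symmetric] by (intro span_sum span_scale span_base)
    then show ?thesis using in_M by (auto simp: f_def U_def)
  qed
  have f_meas: "f \<in> (\<Pi>\<^sub>M b\<in>B. lborel) \<rightarrow>\<^sub>M borel"
  proof -
    have "(\<lambda>c. c b) \<in> borel_measurable (\<Pi>\<^sub>M b\<in>B. lborel)" if "b \<in> B" for b
      using measurable_component_singleton[OF that, of "\<lambda>_. lborel"] by simp
    then show ?thesis unfolding f_def by (intro borel_measurable_add borel_measurable_sum
        borel_measurable_scaleR borel_measurable_const)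
  qed
  have "x - a \<in> span B" using x(1) a B(3) by (auto simp: U_def)
  then obtain c where c: "x - a = (\<Sum>b\<in>B. c b *\<^sub>R b)" using span_finite[OF finB] by auto
  have fc: "f (restrict c B) = x" by (simp add: f_def flip: c)
  have "AE c in (\<Pi>\<^sub>M b\<in>B. lborel). Q (f c) \<noteq> 0"
  proof (rule AE_PiM_lborel_nonroot[OF finB])
    fix c and b :: 'a
    show "\<exists>p. \<forall>t. Q (f (c(b := t))) = poly p t"
    proof (cases "b \<in> B")
      case True
      have "f (c(b := t)) = (a + (\<Sum>b'\<in>B - {b}. c b' *\<^sub>R b')) + t *\<^sub>R b" for t
      proof -
        have "(\<Sum>b'\<in>B - {b}. (c(b := t)) b' *\<^sub>R b') = (\<Sum>b'\<in>B - {b}. c b' *\<^sub>R b')"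
          by (rule sum.cong) auto
        then show ?thesis unfolding f_def by (subst sum.remove[OF finB True]) (simp add: add_ac)
      qed
      then show ?thesis using line by simp
    next
      case False
      have "f (c(b := t)) = f c" for t
        unfolding f_def by (rule arg_cong[where f = "(+) a"], rule sum.cong) (use False in auto)
      then show ?thesis by (intro exI[of _ "[:Q (f c):]"]) simp
    qed
  next
    show "(\<lambda>c. Q (f c)) \<in> borel_measurable (\<Pi>\<^sub>M b\<in>B. lborel)"
      using measurable_compose[OF f_meas meas] .
    show "restrict c B \<in> extensional B" by simp
    show "Q (f (restrict c B)) \<noteq> 0" using fc x(2) by simp
  qed
  moreover have "f \<in> (\<Pi>\<^sub>M b\<in>B. lborel) \<rightarrow>\<^sub>M restrict_space borel M"
    using f_meas f_M by (intro measurable_restrict_space2) auto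
  moreover have "{A \<in> space (restrict_space borel M). Q A \<noteq> 0} \<in> sets (restrict_space borel M)"
  proof -
    have "Q \<in> borel_measurable (restrict_space borel M)"
      using meas by (rule measurable_restrict_space1)
    then show ?thesis by measurable
  qed
  ultimately have "AE A in distr (\<Pi>\<^sub>M b\<in>B. lborel) (restrict_space borel M) f. Q A \<noteq> 0"
    by (subst AE_distr_iff)
  then show ?thesis
    unfolding lborel_affine_def Let_def a_def[symmetric] U_def[symmetric] B_def[symmetric]
    by (simp only: f_def[abs_def])
qed

text \<open>There are only countably many rational polynomials, and each nonzero one vanishes on a
  null set only, as its variables are free coordinates of the affine space.\<close>

lemma AE_alg_indep:
  fixes G :: "'n::finite pair_pre_digraph"
  assumes refl: "\<And>i. (i, i) \<in> parcs G"
  shows "AE A in lborel_affine (consensus_space (with_proj G)).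
    alg_indep (off_diag G) (\<lambda>(i, l). A $ i $ l)"
proof -
  define I where "I = off_diag G"
  define Q where "Q D w A = (\<Sum>m\<in>exps I D. of_rat (w m) * mon I (\<lambda>(i, l). A $ i $ l) m)"
    for D :: nat and w and A :: "real ^ 'n ^ 'n"
  have finI: "finite I" by simp
  let ?W = "\<lambda>D. {w \<in> exps I D \<rightarrow>\<^sub>E (UNIV :: rat set). \<exists>m\<in>exps I D. w m \<noteq> 0}"
  have nonroot: "\<exists>A \<in> consensus_space (with_proj G). Q D w A \<noteq> 0" if w: "w \<in> ?W D" for D w
  proof -
    have "\<exists>m\<in>exps I D. real_of_rat (w m) \<noteq> 0" using w by simp
    from nonzero_polynomial_has_nonroot[OF finI this] obtain x where
      x: "(\<Sum>m\<in>exps I D. real_of_rat (w m) * mon I x m) \<noteq> 0" by blast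
    \<comment> \<open>The diagonal absorbs the row sum condition, so the other entries on arcs can
      be prescribed.\<close>
    define A :: "real ^ 'n ^ 'n" where
      "A = (\<chi> i l. if (i, l) \<in> I then x (i, l) else if i = l then 1 - (\<Sum>l' | (i, l') \<in> I. x (i, l')) else 0)"
    have "(\<Sum>l\<in>UNIV. A $ i $ l) = 1" for i
    proof -
      have "(\<Sum>l\<in>UNIV. A $ i $ l) = (\<Sum>l\<in>UNIV. (if (i, l) \<in> I then x (i, l) else 0) +
          (if l = i then 1 - (\<Sum>l' | (i, l') \<in> I. x (i, l')) else 0))"
        by (rule sum.cong) (auto simp: A_def I_def off_diag_def)
      also have "\<dots> = 1" by (simp add: sum.distrib sum.If_cases)
      finally show ?thesis .
    qed
    then have "A \<in> consensus_space (with_proj G)"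
      using refl by (auto simp: consensus_space_def A_def I_def off_diag_def)
    moreover have "mon I (\<lambda>(i, l). A $ i $ l) m = mon I x m" for m
      unfolding mon_def by (rule prod.cong) (auto simp: A_def)
    then have "Q D w A \<noteq> 0" using x by (simp add: Q_def)
    ultimately show ?thesis by blast
  qed
  have "AE A in lborel_affine (consensus_space (with_proj G)). Q D w A \<noteq> 0" if w: "w \<in> ?W D" for D w
  proof -
    obtain A where A: "A \<in> consensus_space (with_proj G)" "Q D w A \<noteq> 0"
      using nonroot[OF w] by blast
    show ?thesis
    proof (rule AE_lborel_affine_nonroot[where Q = "Q D w", OF _ _ _ A])
      show "affine (consensus_space (with_proj G))"
        by (auto simp: affine_def consensus_space_def sum.distrib simp flip: sum_distrib_left)
    next
      fix x y :: "real ^ 'n ^ 'n"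
      show "\<exists>p. \<forall>t. Q D w (x + t *\<^sub>R y) = poly p t"
        by (intro exI[of _ "\<Sum>m\<in>exps I D. smult (of_rat (w m)) (\<Prod>(i, l)\<in>I. [:x $ i $ l, y $ i $ l:] ^ m (i, l))"])
          (simp add: Q_def mon_def poly_sum poly_prod split_def)
    next
      show "Q D w \<in> borel_measurable borel"
        unfolding Q_def mon_def split_def
        by (intro borel_measurable_continuous_onI continuous_intros)
    qed
  qed
  moreover have countable_W: "countable (?W D)" for D
    by (rule countable_subset[OF _ countable_PiE[of "exps I D" "\<lambda>_. UNIV"]]) (auto simp: finite_exps)
  ultimately have "AE A in lborel_affine (consensus_space (with_proj G)). \<forall>w\<in>?W D. Q D w A \<noteq> 0" for D
    by (subst AE_ball_countable[OF countable_W]) blast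
  then have "AE A in lborel_affine (consensus_space (with_proj G)). \<forall>D. \<forall>w\<in>?W D. Q D w A \<noteq> 0"
    by (simp only: AE_all_countable) blast
  then show ?thesis
  proof eventually_elim
    case (elim A)
    show ?case unfolding alg_indep_def
    proof (intro allI impI)
      fix D :: nat and w :: "('n \<times> 'n \<Rightarrow> nat) \<Rightarrow> rat"
      assume "\<exists>m\<in>exps (off_diag G) D. w m \<noteq> 0"
      then have "restrict w (exps I D) \<in> ?W D" by (auto simp: I_def)
      with elim have "Q D (restrict w (exps I D)) A \<noteq> 0" by blast
      then show "(\<Sum>m\<in>exps (off_diag G) D. of_rat (w m) * mon (off_diag G) (\<lambda>(i, l). A $ i $ l) m) \<noteq> 0"
        by (simp add: Q_def I_def)
    qed
  qed
qed

section \<open>Identifiability\<close>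

lemma state_Suc_component:
  "state A K x0 u (Suc t) $ i =
     (\<Sum>l\<in>UNIV. A $ i $ l * state A K x0 u t $ l) + (if i \<in> K then u t i else 0)"
proof -
  have "apply_B K (u t) $ i = (\<Sum>r\<in>K. if r = i then u t i else 0)"
    unfolding apply_B_def sum_component by (rule sum.cong) (auto simp: axis_def)
  then show ?thesis by (simp add: matrix_vector_mult_def)
qed

text \<open>The agents in \<open>K'\<close> can imitate \<open>u\<close> at \<open>j\<close>; \<open>x\<close> is the difference of the two state sequences.\<close>

definition masked ::
  "'n::finite pair_pre_digraph \<Rightarrow> real ^ 'n ^ 'n \<Rightarrow> 'n \<Rightarrow> 'n set \<Rightarrow> 'n set \<Rightarrow> (nat \<Rightarrow> 'n \<Rightarrow> real) \<Rightarrow> bool"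
where
  "masked G A j K' K u \<longleftrightarrow> (\<exists>u' x.
     (\<forall>t i. x (Suc t) i = (\<Sum>l\<in>UNIV. A $ i $ l * x t l) +
        (if i \<in> K then u t i else 0) - (if i \<in> K' then u' t i else 0)) \<and>
     (\<forall>t i. (i, j) \<in> parcs G \<longrightarrow> x t i = (0::real)))"

lemma unidentifiable_masked:
  assumes "pverts G = UNIV" "unidentifiable (with_proj G) A \<K> K u"
  shows "\<exists>K'\<in>\<K>. K' \<noteq> K \<and> (\<exists>j. masked G A j K' K u)"
proof -
  obtain K' u' x1 x2 j where K': "K' \<in> \<K>" "K' \<noteq> K" and out: "\<And>t. agent_output (with_proj G) A j K x1 u t =
      agent_output (with_proj G) A j K' x2 u' t"
    using assms(2) unfolding unidentifiable_def by (elim bexE conjE exE) (rule that, assumption+, erule spec)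
  define x where "x t i = state A K x1 u t $ i - state A K' x2 u' t $ i" for t i
  have "x (Suc t) i = (\<Sum>l\<in>UNIV. A $ i $ l * x t l) +
      (if i \<in> K then u t i else 0) - (if i \<in> K' then u' t i else 0)" for t i
    unfolding x_def state_Suc_component by (simp add: right_diff_distrib sum_subtractf)
  moreover have "x t i = 0" if "(i, j) \<in> parcs G" for t i
    using fun_cong[OF out[of t], of i] that assms(1) by (simp add: agent_output_def nbrs_def x_def)
  ultimately have "masked G A j K' K u"
    unfolding masked_def by (intro exI[of _ u'] exI[of _ x]) simp
  then show ?thesis using K' by blast
qed

lemma masked_linear:
  assumes "masked G A j K' K u" "masked G A j K' K v"
  shows "masked G A j K' K (\<lambda>t i. a * u t i + b * v t i)"
proof -
  obtain u' x where x: "\<And>t i. x (Suc t) i = (\<Sum>l\<in>UNIV. A $ i $ l * x t l) +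
      (if i \<in> K then u t i else 0) - (if i \<in> K' then u' t i else 0)"
    "\<And>t i. (i, j) \<in> parcs G \<Longrightarrow> x t i = (0::real)"
    using assms(1) unfolding masked_def by blast
  obtain v' y where y: "\<And>t i. y (Suc t) i = (\<Sum>l\<in>UNIV. A $ i $ l * y t l) +
      (if i \<in> K then v t i else 0) - (if i \<in> K' then v' t i else 0)"
    "\<And>t i. (i, j) \<in> parcs G \<Longrightarrow> y t i = (0::real)"
    using assms(2) unfolding masked_def by blast
  have "a * x (Suc t) i + b * y (Suc t) i = (\<Sum>l\<in>UNIV. A $ i $ l * (a * x t l + b * y t l)) +
      (if i \<in> K then a * u t i + b * v t i else 0) - (if i \<in> K' then a * u' t i + b * v' t i else 0)" for t i
  proof -
    have "(\<Sum>l\<in>UNIV. A $ i $ l * (a * x t l + b * y t l)) =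
        a * (\<Sum>l\<in>UNIV. A $ i $ l * x t l) + b * (\<Sum>l\<in>UNIV. A $ i $ l * y t l)"
      by (simp add: distrib_left sum.distrib sum_distrib_left mult_ac)
    then show ?thesis unfolding x(1) y(1) by (simp add: algebra_simps)
  qed
  with x(2) y(2) show ?thesis
    unfolding masked_def
    by (intro exI[of _ "\<lambda>t i. a * u' t i + b * v' t i"] exI[of _ "\<lambda>t i. a * x t i + b * y t i"]) auto
qed

text \<open>The difference of the two state sequences has zero output and inputs in
  \<open>K \<union> K'\<close> only, so it is zero; its equation at \<open>i\<close> then leaves
  only \<open>u t i\<close>.\<close>

lemma masked_input_vanishes:
  fixes G :: "'n::finite pair_pre_digraph"
  assumes sep: "separated k G" and refl: "\<And>i. (i, i) \<in> parcs G"
    and A: "A \<in> consensus_space (with_proj G)" "alg_indep (off_diag G) (\<lambda>(i, l). A $ i $ l)"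
    and masked: "masked G A j K' K u" and K: "card (K \<union> K') < k" and i: "i \<in> K - K'"
  shows "u t i = 0"
proof -
  obtain u' x where x: "\<And>t i. x (Suc t) i = (\<Sum>l\<in>UNIV. A $ i $ l * x t l) +
      (if i \<in> K then u t i else 0) - (if i \<in> K' then u' t i else 0)"
    "\<And>t i. (i, j) \<in> parcs G \<Longrightarrow> x t i = (0::real)"
    using masked unfolding masked_def by blast
  have "x t i = 0" for t i
    by (rule zero_output_trajectory_vanishes[OF sep refl A, of "K \<union> K'" x j]) (use x K in auto)
  then show ?thesis using x(1)[of t i] i by simp
qed

text \<open>Otherwise the impulses of \<open>i\<close> at all times would be masked. The difference
  sequences have inputs in \<open>insert i K'\<close>, a set of up to \<open>k\<close> agents: this
  is where the bound for rational \<open>z\<close> enters.\<close>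

lemma not_all_inputs_masked:
  fixes G :: "'n::finite pair_pre_digraph"
  assumes sep: "separated k G" and refl: "\<And>i. (i, i) \<in> parcs G"
    and A: "A \<in> consensus_space (with_proj G)" "alg_indep (off_diag G) (\<lambda>(i, l). A $ i $ l)"
    and K: "card K' < k" "i \<in> K - K'"
  shows "\<exists>u. \<not> masked G A j K' K u"
proof (rule ccontr)
  assume "\<not> ?thesis"
  then have masked: "masked G A j K' K (\<lambda>t l. if l = i \<and> t = s then 1 else 0)" for s by blast
  let ?cancels = "\<lambda>s x. (\<forall>t l. l \<notin> insert i K' \<longrightarrow> x (Suc t) l = (\<Sum>l'\<in>UNIV. A $ l $ l' * x t l')) \<and>
      (\<forall>t. x (Suc t) i = (\<Sum>l'\<in>UNIV. A $ i $ l' * x t l') + (if t = s then 1 else 0)) \<and>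
      (\<forall>t l. (l, j) \<in> parcs G \<longrightarrow> x t l = 0)"
  have "\<exists>x. ?cancels s x" for s
  proof -
    obtain u' x where "\<forall>t l. x (Suc t) l = (\<Sum>l'\<in>UNIV. A $ l $ l' * x t l') +
        (if l \<in> K then if l = i \<and> t = s then 1 else 0 else 0) - (if l \<in> K' then u' t l else 0)"
      "\<forall>t l. (l, j) \<in> parcs G \<longrightarrow> x t l = (0::real)"
      using masked[of s] unfolding masked_def by blast
    with K show ?thesis by (intro exI[of _ x]) simp
  qed
  then have "\<forall>s. \<exists>x. ?cancels s x" by blast
  from choice[OF this] obtain x where x: "\<forall>s. ?cancels s (x s)" ..
  show False
    by (rule not_all_impulses_cancellable[OF sep refl A, of "insert i K'" x i j])
      (use x K in \<open>auto simp: card_insert_if\<close>)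
qed

text \<open>Let \<open>u\<close> avoid all predicates but that of \<open>p\<close>, and let
  \<open>w\<close> avoid that one. The line \<open>u + c w\<close> then meets the one of
  \<open>p\<close> only at \<open>c = 0\<close> and each other one at most once, so some
  \<open>c\<close> avoids them all.\<close>

lemma avoid_finitely_many_subspaces:
  fixes P :: "'p \<Rightarrow> ('s \<Rightarrow> 't \<Rightarrow> real) \<Rightarrow> bool"
  assumes "finite X"
    and "\<And>p u v a b. p \<in> X \<Longrightarrow> P p u \<Longrightarrow> P p v \<Longrightarrow> P p (\<lambda>s t. a * u s t + b * v s t)"
    and "\<And>p. p \<in> X \<Longrightarrow> \<exists>u. \<not> P p u"
  shows "\<exists>u. \<forall>p\<in>X. \<not> P p u"
  using assms
proof (induction X rule: finite_induct)
  case (insert p X)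
  obtain u where u: "\<forall>q\<in>X. \<not> P q u"
    using insert.IH[OF insert.prems] by auto
  obtain w where w: "\<not> P p w" using insert.prems(2)[of p] by auto
  show ?case
  proof (cases "P p u")
    case False
    then show ?thesis using u by (intro exI[of _ u]) simp
  next
    case True
    define g where "g c = (\<lambda>s t. u s t + c * w s t)" for c
    have "finite {c. P q (g c)}" if q: "q \<in> X" for q
    proof -
      have "c = d" if "P q (g c)" "P q (g d)" for c d
      proof (rule ccontr)
        assume "c \<noteq> d"
        define r where "r = 1 / (c - d)"
        have "- d * r * g c s t + c * r * g d s t = r * (c - d) * u s t" for s t
          by (simp add: g_def algebra_simps)
        then have "u = (\<lambda>s t. (- d * r) * g c s t + (c * r) * g d s t)"
          using \<open>c \<noteq> d\<close> by (simp add: r_def)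
        moreover have "P q \<dots>"
          using insert.prems(1)[of q "g c" "g d" "- d * r" "c * r"] that q by simp
        ultimately have "P q u" by (rule ssubst[where P = "P q"])
        then show False using u q by blast
      qed
      then have sub: "{c. P q (g c)} \<subseteq> {d}" if "P q (g d)" for d
        using that by auto
      show ?thesis
      proof (cases "\<exists>d. P q (g d)")
        case True
        then obtain d where "P q (g d)" ..
        from finite_subset[OF sub[OF this]] show ?thesis by simp
      qed simp
    qed
    then have "finite (insert 0 (\<Union>q\<in>X. {c. P q (g c)}))" using insert.hyps by simp
    from ex_new_if_finite[OF infinite_UNIV_char_0 this] obtain c
      where "c \<notin> insert 0 (\<Union>q\<in>X. {c. P q (g c)})" ..
    then have c: "c \<noteq> 0" "\<forall>q\<in>X. \<not> P q (g c)" by simp_all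
    have "\<not> P p (g c)"
    proof
      assume "P p (g c)"
      have "w = (\<lambda>s t. (1 / c) * g c s t + (- 1 / c) * u s t)"
        using c(1) by (simp add: g_def fun_eq_iff field_simps)
      moreover have "P p \<dots>"
        using insert.prems(1)[of p "g c" u "1 / c" "- 1 / c"] \<open>P p (g c)\<close> True by simp
      ultimately have "P p w" by (rule ssubst[where P = "P p"])
      then show False using w by blast
    qed
    then show ?thesis using c(2) by (intro exI[of _ "g c"]) simp
  qed
qed simp

theorem mainTheorem5:
  fixes G :: "'n::finite pair_pre_digraph" and k :: nat
  assumes "pair_fin_digraph G"
    and "pverts G = UNIV"
    and "\<forall>i. (i, i) \<in> parcs G"
    and "k_connected k (with_proj G)"
  shows "AE A in lborel_affine (consensus_space (with_proj G)).
    consensus_matrix (with_proj G) A \<longrightarrow>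
      (let \<K> = {K. int (card K) = \<lfloor>(real k - 1) / 2\<rfloor>} in
         \<forall>K\<in>\<K>. K \<noteq> {} \<longrightarrow>
           (\<forall>u. (\<forall>i\<in>K. misbehaving u i) \<longrightarrow> identifiable (with_proj G) A \<K> K u)) \<and>
      (let \<K> = {K. int (card K) = int k - 1} in
         \<forall>K\<in>\<K>. K \<noteq> {} \<longrightarrow>
           (\<exists>u. (\<forall>i\<in>K. misbehaving u i) \<and> identifiable (with_proj G) A \<K> K u))"
proof -
  have refl: "\<And>i. (i, i) \<in> parcs G" using assms(3) by blast
  have sep: "separated k G" using k_connected_separated assms(2,4) by blast
  show ?thesis
    using AE_alg_indep[OF refl]
  proof eventually_elim
    case (elim A)
    show ?case
    proof (intro impI)
      assume "consensus_matrix (with_proj G) A"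
      then have A: "A \<in> consensus_space (with_proj G)"
        by (simp add: consensus_matrix_def row_stochastic_def consensus_space_def)
      note gen = sep refl A elim
      have nonsubset: "\<exists>i. i \<in> K - K'" if "card K = card K'" "K' \<noteq> K" for K K' :: "'n set"
        using that card_subset_eq[of K' K] by auto
      have "identifiable (with_proj G) A {K. int (card K) = \<lfloor>(real k - 1) / 2\<rfloor>} K u"
        if K: "int (card K) = \<lfloor>(real k - 1) / 2\<rfloor>" and u: "\<forall>i\<in>K. misbehaving u i" for K u
      proof
        assume "unidentifiable (with_proj G) A {K. int (card K) = \<lfloor>(real k - 1) / 2\<rfloor>} K u"
        from unidentifiable_masked[OF assms(2) this] obtain K' j
          where K': "int (card K') = \<lfloor>(real k - 1) / 2\<rfloor>" "K' \<noteq> K"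
            and masked: "masked G A j K' K u" by blast
        have cards: "card K = card K'" using K K' by simp
        obtain i where i: "i \<in> K - K'" using nonsubset[OF cards K'(2)] by blast
        have "real (card K) = of_int \<lfloor>(real k - 1) / 2\<rfloor>" by (simp only: K[symmetric] of_int_of_nat_eq)
        also have "\<dots> \<le> (real k - 1) / 2" by (rule of_int_floor_le)
        finally have "real (card K + card K') < real k" using cards by simp
        then have "card K + card K' < k" by (simp only: of_nat_less_iff)
        then have "card (K \<union> K') < k" using card_Un_le[of K K'] by linarith
        from masked_input_vanishes[OF gen masked this i] show False
          using u i by (auto simp: misbehaving_def)
      qed
      moreover have "\<exists>u. (\<forall>i\<in>K. misbehaving u i) \<and> identifiable (with_proj G) A {K. int (card K) = int k - 1} K u"
        if K: "int (card K) = int k - 1" for K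
      proof -
        \<comment> \<open>Besides the inputs masked by \<open>K'\<close> at \<open>j\<close>, the
          inputs for which an agent \<open>i\<close> of \<open>K\<close> stays silent form a proper
          subspace. Avoiding both kinds gives identifiability and misbehavior of all agents at
          once.\<close>
        define X where "X = Inl ` ({K'. int (card K') = int k - 1 \<and> K' \<noteq> K} \<times> (UNIV :: 'n set)) \<union> Inr ` K"
        define P where "P = case_sum (\<lambda>(K', j). masked G A j K' K) (\<lambda>i u. \<forall>t. u t i = 0)"
        have "\<exists>u. \<forall>p\<in>X. \<not> P p u"
        proof (rule avoid_finitely_many_subspaces)
          show "finite X" by (simp add: X_def)
        next
          fix p assume "p \<in> X"
          show "\<exists>u. \<not> P p u"
          proof (cases p)
            case (Inl q)
            then obtain K' j where q: "p = Inl (K', j)" "int (card K') = int k - 1" "K' \<noteq> K"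
              using \<open>p \<in> X\<close> by (auto simp: X_def)
            then have "card K = card K'" "card K' < k" using K by linarith+
            with nonsubset q(3) obtain i where "i \<in> K - K'" by blast
            from not_all_inputs_masked[OF gen \<open>card K' < k\<close> this] show ?thesis
              by (simp add: P_def q(1))
          next
            case (Inr i)
            then show ?thesis by (auto simp: P_def intro: exI[of _ "\<lambda>_ _. 1"])
          qed
        next
          fix p u v and a b :: real
          assume "P p u" "P p v"
          then show "P p (\<lambda>t i. a * u t i + b * v t i)"
            by (simp add: P_def masked_linear split: sum.splits prod.splits)
        qed
        then obtain u where "\<forall>p\<in>X. \<not> P p u" ..
        then have u: "\<not> P p u" if "p \<in> X" for p using that by (rule bspec)
        have "misbehaving u i" if "i \<in> K" for i
          using u[of "Inr i"] that by (simp add: X_def P_def misbehaving_def)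
        moreover have "identifiable (with_proj G) A {K. int (card K) = int k - 1} K u"
        proof
          assume "unidentifiable (with_proj G) A {K. int (card K) = int k - 1} K u"
          from unidentifiable_masked[OF assms(2) this] obtain K' j
            where "int (card K') = int k - 1" "K' \<noteq> K" "masked G A j K' K u" by blast
          then show False using u[of "Inl (K', j)"] by (auto simp: X_def P_def)
        qed
        ultimately show ?thesis by blast
      qed
      ultimately show "(let \<K> = {K. int (card K) = \<lfloor>(real k - 1) / 2\<rfloor>} in
         \<forall>K\<in>\<K>. K \<noteq> {} \<longrightarrow>
           (\<forall>u. (\<forall>i\<in>K. misbehaving u i) \<longrightarrow> identifiable (with_proj G) A \<K> K u)) \<and>
      (let \<K> = {K. int (card K) = int k - 1} in
         \<forall>K\<in>\<K>. K \<noteq> {} \<longrightarrow>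
           (\<exists>u. (\<forall>i\<in>K. misbehaving u i) \<and> identifiable (with_proj G) A \<K> K u))"
        unfolding Let_def by blast
    qed
  qed
qed

end
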